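(* Let $(\mathbb{X},\mathbb{U},\mathcal{T},c)$ be a Markov decision process with $\mathbb{X}\subseteq\mathbb{R}^n$ Borel such that: (A1) $\mathbb{U}$ is compact (and finite); $c:\mathbb{X}\times\mathbb{U}\to\mathbb{R}$ is nonnegative, bounded and continuous; $\mathcal{T}$ is weak Feller, i.e. $(x,u)\mapsto\int g(x_1)\,\mathcal{T}(dx_1|x,u)$ is continuous for every bounded continuous $g:\mathbb{X}\to\mathbb{R}$; (A2) there are constants $\alpha_c,\alpha_T>0$ such that for all $x,x'\in\mathbb{X}$, $u\in\mathbb{U}$: $|c(x,u)-c(x',u)|\le\alpha_c\|x-x'\|_1$ and $\|\mathcal{T}(\cdot|x,u)-\mathcal{T}(\cdot|x',u)\|_{TV}\le\alpha_T\|x-x'\|_1$; (A3) (minorization) there is a non-trivial positive measure $\mu$ on $\mathbb{X}$ such that $\mathcal{T}(B|x,u)\ge\mu(B)$ for all $(x,u)\in\mathbb{X}\times\mathbb{U}$ and all Borel $B\subseteq\mathbb{X}$. Let $f(x)=\|x\|_1^m$ with $m>1$, and suppose there are $b\ge0$ and a Lyapunov function $V:\mathbb{X}\to[0,\infty)$ such that $$\mathbb{E}[V(X_{t+1})\mid X_t=x,U_t=u]\le V(x)-f(x)+b\qquad\text{for all }x\in\mathbb{X},\ u\in\mathbb{U}.$$ Then, with $M$ denoting the number of bins, there exists a quantizer which leads to the following error bound for any initial state $x_0\in\mathbb{X}$: $$\left|\hat J_{avg}(x_0)-J^*_{avg}(x_0)\right|\le\left(\alpha_c+\frac{\alpha_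T\|c\|_\infty}{\mu(\mathbb{X})}\right)\frac{(2n+1)\,b^{1/m}}{M^{\frac1n\left(1-\frac1m\right)}}.$$
   Context: MDP: $\mathcal{T}(\cdot|x,u)$ is a stochastic kernel from $\mathbb{X}\times\mathbb{U}$ to $\mathbb{X}$, the law of $X_{t+1}$ given $X_t=x,U_t=u$. An admissible policy $\gamma=\{\gamma_t\}$ chooses $U_t=\gamma_t(X_0,\dots,X_t,U_0,\dots,U_{t-1})$ measurably. $J_{avg}(x,\gamma)=\limsup_{T\to\infty}\frac1T\mathbb{E}^\gamma_x[\sum_{t=0}^{T-1}c(X_t,U_t)]$ and $J^*_{avg}(x)=\inf_\gamma J_{avg}(x,\gamma)$ over admissible $\gamma$. $\|\cdot\|_1$ is the $\ell_1$ norm on $\mathbb{R}^n$. Quantizer: $\mathbb{X}$ is partitioned into $M$ disjoint bins $B_1,\dots,B_M$ with union $\mathbb{X}$; a representative state $y_i\in B_i$ is selected in each bin, $\mathbb{Y}=\{y_1,\dots,y_M\}$, and $q(x)=y_i$ for $x\in B_i$. A weighting probability measure $\pi$ on $\mathbb{X}$ with $\pi(B_i)>0$ for every $i$ is chosen (in this planning setting it is a design choice), and $\hat\pi_{y_i}(A)=\pi(A)/\pi(B_i)$ for $A\subseteq B_i$. Finite model: state space $\mathbb{Y}$, with $C^*(y_i,u)=\int_{B_i}c(x,u)\,\hat\pi_{y_i}(dx)$ and $P^*(y_j|y_i,u)=\int_{B_i}\mathcal{T}(B_j|x,u)\,\hat\pi_{y_i}(dx)$. $\hat J_{avg}(x)$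 is the optimal infinite-horizon average cost of this finite MDP started from $q(x)$. Total variation convention: $\|\mu-\nu\|_{TV}=\sup_{\|f\|_\infty\le1}|\int f\,d\mu-\int f\,d\nu|$. *)

theory Defs
  imports "HOL-Probability.Probability"
begin

definition l1_norm :: "real ^ 'n \<Rightarrow> real" where
  "l1_norm x = (\<Sum>i\<in>UNIV. \<bar>x $ i\<bar>)"

(* Normalised so that probability measures have distance at most 2. *)
definition tv_dist :: "'a measure \<Rightarrow> 'a measure \<Rightarrow> real" where
  "tv_dist \<mu> \<nu> =
     (SUP f \<in> {f \<in> borel_measurable \<mu>. \<forall>x\<in>space \<mu>. \<bar>f x\<bar> \<le> (1::real)}.
        \<bar>(LINT x|\<mu>. f x) - (LINT x|\<nu>. f x)\<bar>)"

definition stochastic_kernel ::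
    "'x measure \<Rightarrow> 'u measure \<Rightarrow> ('x \<Rightarrow> 'u \<Rightarrow> 'x measure) \<Rightarrow> bool" where
  "stochastic_kernel MX MU T \<longleftrightarrow> (\<lambda>(x, u). T x u) \<in> MX \<Otimes>\<^sub>M MU \<rightarrow>\<^sub>M prob_algebra MX"

definition weak_feller ::
    "'x::topological_space set \<Rightarrow> 'u::topological_space set \<Rightarrow> ('x \<Rightarrow> 'u \<Rightarrow> 'x measure) \<Rightarrow> bool" where
  "weak_feller X U T \<longleftrightarrow>
     (\<forall>g::'x \<Rightarrow> real. continuous_on X g \<and> bounded (g ` X) \<longrightarrow>
        continuous_on (X \<times> U) (\<lambda>(x, u). LINT x'|T x u. g x'))"

(* A policy is a sequence of measurable maps from histories
   ((X_0, ..., X_t), (U_0, ..., U_{t-1})) to actions. *)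
type_synonym ('x, 'u) policy = "nat \<Rightarrow> (nat \<Rightarrow> 'x) \<Rightarrow> (nat \<Rightarrow> 'u) \<Rightarrow> 'u"

definition admissible_policies :: "'x measure \<Rightarrow> 'u measure \<Rightarrow> ('x, 'u) policy set" where
  "admissible_policies MX MU =
     {\<gamma>. \<forall>t. (\<lambda>(xs, us). \<gamma> t xs us) \<in> PiM {..t} (\<lambda>_. MX) \<Otimes>\<^sub>M PiM {..<t} (\<lambda>_. MU) \<rightarrow>\<^sub>M MU}"

(* The conditional law of (X_t, U_t) given that (X_i, U_i) = \<omega> i for all i < t,
   under the policy \<gamma> and with X_0 = x. *)
definition step_kernel ::
    "'x measure \<Rightarrow> 'u measure \<Rightarrow> ('x \<Rightarrow> 'u \<Rightarrow> 'x measure) \<Rightarrow> ('x, 'u) policy \<Rightarrow> 'x \<Rightarrow>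
     nat \<Rightarrow> (nat \<Rightarrow> 'x \<times> 'u) \<Rightarrow> ('x \<times> 'u) measure" where
  "step_kernel MX MU T \<gamma> x t \<omega> =
     distr (case t of 0 \<Rightarrow> return MX x | Suc s \<Rightarrow> T (fst (\<omega> s)) (snd (\<omega> s))) (MX \<Otimes>\<^sub>M MU)
       (\<lambda>x'. (x', \<gamma> t (\<lambda>i\<in>{..t}. if i = t then x' else fst (\<omega> i)) (\<lambda>i\<in>{..<t}. snd (\<omega> i))))"

(* The law of the trajectory (X_t, U_t)_{t \<ge> 0}: the projective limit given by the
   Ionescu Tulcea theorem. *)
definition trajectory_measure ::
    "'x measure \<Rightarrow> 'u measure \<Rightarrow> ('x \<Rightarrow> 'u \<Rightarrow> 'x measure) \<Rightarrow> ('x, 'u) policy \<Rightarrow> 'x \<Rightarrow>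
     (nat \<Rightarrow> 'x \<times> 'u) measure" where
  "trajectory_measure MX MU T \<gamma> x =
     projective_family.lim UNIV
       (Ionescu_Tulcea.CI (step_kernel MX MU T \<gamma> x) (\<lambda>_. MX \<Otimes>\<^sub>M MU)) (\<lambda>_. MX \<Otimes>\<^sub>M MU)"

definition avg_cost ::
    "'x measure \<Rightarrow> 'u measure \<Rightarrow> ('x \<Rightarrow> 'u \<Rightarrow> 'x measure) \<Rightarrow> ('x \<Rightarrow> 'u \<Rightarrow> real) \<Rightarrow>
     'x \<Rightarrow> ('x, 'u) policy \<Rightarrow> ereal" where
  "avg_cost MX MU T c x \<gamma> =
     limsup (\<lambda>N. ereal (1 / real N *
       (LINT \<omega>|trajectory_measure MX MU T \<gamma> x. (\<Sum>t<N. c (fst (\<omega> t)) (snd (\<omega> t))))))"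

definition opt_avg_cost ::
    "'x measure \<Rightarrow> 'u measure \<Rightarrow> ('x \<Rightarrow> 'u \<Rightarrow> 'x measure) \<Rightarrow> ('x \<Rightarrow> 'u \<Rightarrow> real) \<Rightarrow> 'x \<Rightarrow> ereal" where
  "opt_avg_cost MX MU T c x = (INF \<gamma> \<in> admissible_policies MX MU. avg_cost MX MU T c x \<gamma>)"

(* The bins are B 0, ..., B (M - 1), with representatives y 0, ..., y (M - 1) and
   weighting measure \<pi>. *)
definition quantizer ::
    "'x::topological_space set \<Rightarrow> nat \<Rightarrow> (nat \<Rightarrow> 'x set) \<Rightarrow> (nat \<Rightarrow> 'x) \<Rightarrow> 'x measure \<Rightarrow> bool" where
  "quantizer X M B y \<pi> \<longleftrightarrow>
     (\<forall>i<M. B i \<in> sets (restrict_space borel X)) \<and>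
     disjoint_family_on B {..<M} \<and> (\<Union>i<M. B i) = X \<and>
     (\<forall>i<M. y i \<in> B i) \<and>
     \<pi> \<in> space (prob_algebra (restrict_space borel X)) \<and>
     (\<forall>i<M. measure \<pi> (B i) > 0)"

definition bin_index :: "nat \<Rightarrow> (nat \<Rightarrow> 'x set) \<Rightarrow> 'x \<Rightarrow> nat" where
  "bin_index M B x = (THE i. i < M \<and> x \<in> B i)"

definition quantize :: "nat \<Rightarrow> (nat \<Rightarrow> 'x set) \<Rightarrow> (nat \<Rightarrow> 'x) \<Rightarrow> 'x \<Rightarrow> 'x" where
  "quantize M B y x = y (bin_index M B x)"

abbreviation bin :: "nat \<Rightarrow> (nat \<Rightarrow> 'x set) \<Rightarrow> 'x \<Rightarrow> 'x set" where
  "bin M B z \<equiv> B (bin_index M B z)"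

(* "uniform_measure \<pi> A" is the conditional measure \<pi>(- \<inter> A) / \<pi>(A), so for z = y i
   the integrating measure below is \<pi> conditioned on B i. *)
definition finite_cost ::
    "nat \<Rightarrow> (nat \<Rightarrow> 'x set) \<Rightarrow> 'x measure \<Rightarrow> ('x \<Rightarrow> 'u \<Rightarrow> real) \<Rightarrow> 'x \<Rightarrow> 'u \<Rightarrow> real" where
  "finite_cost M B \<pi> c z u = (LINT x:bin M B z|uniform_measure \<pi> (bin M B z). c x u)"

definition finite_prob ::
    "nat \<Rightarrow> (nat \<Rightarrow> 'x set) \<Rightarrow> 'x measure \<Rightarrow> ('x \<Rightarrow> 'u \<Rightarrow> 'x measure) \<Rightarrow> 'x \<Rightarrow> 'u \<Rightarrow> 'x \<Rightarrow> real" where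
  "finite_prob M B \<pi> T z u z' =
     (LINT x:bin M B z|uniform_measure \<pi> (bin M B z). measure (T x u) (bin M B z'))"

definition finite_kernel ::
    "nat \<Rightarrow> (nat \<Rightarrow> 'x set) \<Rightarrow> (nat \<Rightarrow> 'x) \<Rightarrow> 'x measure \<Rightarrow> ('x \<Rightarrow> 'u \<Rightarrow> 'x measure) \<Rightarrow>
     'x \<Rightarrow> 'u \<Rightarrow> 'x measure" where
  "finite_kernel M B y \<pi> T z u =
     point_measure (y ` {..<M}) (\<lambda>z'. ennreal (finite_prob M B \<pi> T z u z'))"

definition finite_opt_avg_cost ::
    "nat \<Rightarrow> (nat \<Rightarrow> 'x set) \<Rightarrow> (nat \<Rightarrow> 'x) \<Rightarrow> 'x measure \<Rightarrow> 'u measure \<Rightarrow>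
     ('x \<Rightarrow> 'u \<Rightarrow> 'x measure) \<Rightarrow> ('x \<Rightarrow> 'u \<Rightarrow> real) \<Rightarrow> 'x \<Rightarrow> ereal" where
  "finite_opt_avg_cost M B y \<pi> MU T c x =
     opt_avg_cost (count_space (y ` {..<M})) MU (finite_kernel M B y \<pi> T) (finite_cost M B \<pi> c)
       (quantize M B y x)"

end

theory Submission
  imports Defs
begin

text \<open>
  Let \<open>q\<close> map \<open>x\<close> to its nearest point in a finite set \<open>S\<close> of \<open>M\<close> points, and let the weighting measure
  be uniform on \<open>S\<close>. The finite model then has costs \<open>c(s, u)\<close> and transition probabilities
  \<open>T(q = s' | s, u)\<close>, and by minorization its average cost optimality equation
  \<open>g + H(s) = min_u {c(s, u) + E[H(q X') | s, u]}\<close> has a solution with \<open>0 \<le> H \<le> K / \<mu>(X)\<close>, where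
  \<open>K\<close> is the supremum of \<open>c\<close>. By the Lipschitz conditions, \<open>H o q\<close> solves the optimality equation of
  the original model up to an error \<open>L |x - q(x)|\<close>, where \<open>L = \<alpha>c + \<alpha>T K / \<mu>(X)\<close>. If
  \<open>|x - q(x)| \<le> a + k f(x)\<close>, the drift condition turns this into a constant error \<open>L (a + k b)\<close> plus
  \<open>L k\<close> times a drift of \<open>V\<close>, which telescopes under every policy and so vanishes in the average.

  It remains to choose \<open>S\<close> with \<open>a + k b \<le> (2n + 1) D\<close>, where \<open>D = b^(1/m) M^(-(1/n)(1 - 1/m))\<close>. With
  \<open>R = b^(1/m) M^(1/(nm))\<close> one has \<open>|x| \<le> (D / b) |x|^m\<close> for \<open>|x| > R\<close>. Inside the ball of radius \<open>R\<close> a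
  maximal \<open>r\<close>-separated subset of \<open>X\<close> containing a point of norm at most \<open>b^(1/m)\<close> is used. It has
  fewer than \<open>(1 + 2R/r)^n\<close> elements by comparison of volumes, and no element has to be an
  (in \<open>X\<close> possibly unavailable) centre of a cell. Points outside the ball are compared
  with the point of small norm. Such a point exists because \<open>f > b\<close> everywhere would contradict
  the minorization.
\<close>

section \<open>Trajectories of a controlled process\<close>

locale controlled_process =
  fixes MX :: "'x measure" and MU :: "'u measure" and T :: "'x \<Rightarrow> 'u \<Rightarrow> 'x measure"
    and \<gamma> :: "('x, 'u) policy" and x0 :: 'x
  assumes kernel: "stochastic_kernel MX MU T"
    and policy: "\<gamma> \<in> admissible_policies MX MU"
    and start: "x0 \<in> space MX"
begin

abbreviation "MXU \<equiv> MX \<Otimes>\<^sub>M MU"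

text \<open>The step kernel is the image of this law under the graph map of
  \<open>act t \<omega>\<close>, so integrating over one step means integrating over the new state
  alone.\<close>

definition state_law :: "nat \<Rightarrow> (nat \<Rightarrow> 'x \<times> 'u) \<Rightarrow> 'x measure" where
  "state_law t \<omega> = (case t of 0 \<Rightarrow> return MX x0 | Suc s \<Rightarrow> T (fst (\<omega> s)) (snd (\<omega> s)))"

definition act :: "nat \<Rightarrow> (nat \<Rightarrow> 'x \<times> 'u) \<Rightarrow> 'x \<Rightarrow> 'u" where
  "act t \<omega> x = \<gamma> t (\<lambda>i\<in>{..t}. if i = t then x else fst (\<omega> i)) (\<lambda>i\<in>{..<t}. snd (\<omega> i))"

lemma step_kernel_eq:
  "step_kernel MX MU T \<gamma> x0 t \<omega> = distr (state_law t \<omega>) MXU (\<lambda>x. (x, act t \<omega> x))"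
  by (simp add: step_kernel_def state_law_def act_def)

lemma measurable_kernel [measurable]: "(\<lambda>(x, u). T x u) \<in> MXU \<rightarrow>\<^sub>M subprob_algebra MX"
  using kernel by (simp add: stochastic_kernel_def measurable_prob_algebraD)

lemma prob_space_kernel: "x \<in> space MX \<Longrightarrow> u \<in> space MU \<Longrightarrow> prob_space (T x u)"
  and sets_kernel: "x \<in> space MX \<Longrightarrow> u \<in> space MU \<Longrightarrow> sets (T x u) = sets MX"
  using measurable_space[OF kernel[unfolded stochastic_kernel_def], of "(x, u)"]
  by (auto simp: space_pair_measure space_prob_algebra)

lemma measurable_state_law [measurable]:
  "state_law t \<in> PiM {0..<t} (\<lambda>_. MXU) \<rightarrow>\<^sub>M subprob_algebra MX"
proof (cases t)
  case 0
  have "return MX x0 \<in> space (subprob_algebra MX)"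
    using start by (simp add: space_subprob_algebra subprob_space_return)
  then show ?thesis by (simp add: state_law_def[abs_def] 0)
next
  case (Suc s)
  have "(\<lambda>\<omega>. \<omega> s) \<in> PiM {0..<t} (\<lambda>_. MXU) \<rightarrow>\<^sub>M MXU"
    using Suc by (intro measurable_component_singleton) auto
  from measurable_compose[OF this measurable_kernel] show ?thesis
    by (simp add: state_law_def[abs_def] Suc split_beta)
qed

lemma state_law_space:
  assumes "\<omega> \<in> space (PiM {0..<t} (\<lambda>_. MXU))"
  shows "sets (state_law t \<omega>) = sets MX" "space (state_law t \<omega>) = space MX"
  using subprob_measurableD[OF measurable_state_law assms] by auto

lemma prob_space_state_law:
  assumes "\<omega> \<in> space (PiM {0..<t} (\<lambda>_. MXU))"
  shows "prob_space (state_law t \<omega>)"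
proof (cases t)
  case 0 then show ?thesis using start by (simp add: state_law_def prob_space_return)
next
  case (Suc s)
  with assms have "\<omega> s \<in> space MXU" by (auto simp: space_PiM)
  then show ?thesis
    by (auto simp: state_law_def Suc space_pair_measure intro: prob_space_kernel)
qed

lemma measurable_act [measurable]:
  "(\<lambda>(\<omega>, x). act t \<omega> x) \<in> PiM {0..<t} (\<lambda>_. MXU) \<Otimes>\<^sub>M MX \<rightarrow>\<^sub>M MU"
proof -
  let ?N = "PiM {0..<t} (\<lambda>_. MXU) \<Otimes>\<^sub>M MX"
  have comp: "(\<lambda>p. fst p i) \<in> ?N \<rightarrow>\<^sub>M MXU" if "i < t" for i
    using that by (intro measurable_compose[OF measurable_fst measurable_component_singleton]) auto
  have xs: "(\<lambda>p. \<lambda>i\<in>{..t}. if i = t then snd p else fst (fst p i)) \<in> ?N \<rightarrow>\<^sub>M PiM {..t} (\<lambda>_. MX)"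
  proof (intro measurable_restrict)
    fix i assume "i \<in> {..t}"
    then show "(\<lambda>p. if i = t then snd p else fst (fst p i)) \<in> ?N \<rightarrow>\<^sub>M MX"
      using measurable_compose[OF comp measurable_fst, of i] by (cases "i = t") auto
  qed
  have us: "(\<lambda>p. \<lambda>i\<in>{..<t}. snd (fst p i)) \<in> ?N \<rightarrow>\<^sub>M PiM {..<t} (\<lambda>_. MU)"
    using measurable_compose[OF comp measurable_snd] by (intro measurable_restrict) auto
  have "(\<lambda>(xs, us). \<gamma> t xs us) \<in> PiM {..t} (\<lambda>_. MX) \<Otimes>\<^sub>M PiM {..<t} (\<lambda>_. MU) \<rightarrow>\<^sub>M MU"
    using policy by (simp add: admissible_policies_def)
  from measurable_compose[OF measurable_Pair[OF xs us] this] show ?thesis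
    by (simp add: act_def split_beta)
qed

lemma measurable_act_at:
  "\<omega> \<in> space (PiM {0..<t} (\<lambda>_. MXU)) \<Longrightarrow> act t \<omega> \<in> MX \<rightarrow>\<^sub>M MU"
  using measurable_compose_Pair1[OF _ measurable_act] by simp

lemma measurable_state_act:
  assumes w: "\<omega> \<in> space (PiM {0..<t} (\<lambda>_. MXU))"
  shows "(\<lambda>x. (x, act t \<omega> x)) \<in> state_law t \<omega> \<rightarrow>\<^sub>M MXU"
  unfolding measurable_cong_sets[OF state_law_space(1)[OF w] refl]
  using measurable_act_at[OF w] by simp

lemma measurable_step_kernel:
  "step_kernel MX MU T \<gamma> x0 t \<in> PiM {0..<t} (\<lambda>_. MXU) \<rightarrow>\<^sub>M subprob_algebra MXU"
proof -
  have "(\<lambda>\<omega>. distr (state_law t \<omega>) MXU ((\<lambda>\<omega> x. (x, act t \<omega> x)) \<omega>))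
      \<in> PiM {0..<t} (\<lambda>_. MXU) \<rightarrow>\<^sub>M subprob_algebra MXU"
    by (rule measurable_distr2) measurable
  then show ?thesis by (simp add: step_kernel_eq[abs_def])
qed

sublocale Ionescu_Tulcea "step_kernel MX MU T \<gamma> x0" "\<lambda>_. MXU"
proof (rule Ionescu_Tulcea.intro)
  show "step_kernel MX MU T \<gamma> x0 t \<in> PiM {0..<t} (\<lambda>_. MXU) \<rightarrow>\<^sub>M subprob_algebra MXU" for t
    by (rule measurable_step_kernel)
  show "prob_space (step_kernel MX MU T \<gamma> x0 t \<omega>)"
    if "\<omega> \<in> space (PiM {0..<t} (\<lambda>_. MXU))" for t \<omega>
    unfolding step_kernel_eq
    by (rule prob_space.prob_space_distr[OF prob_space_state_law[OF that] measurable_state_act[OF that]])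
qed

text \<open>The law of the first \<open>t\<close> state-action pairs. The point
  \<open>\<lambda>_. undefined\<close> is the only element of the product over the empty index set,
  that is, the empty history.\<close>

abbreviation "history t \<equiv> C 0 t (\<lambda>_. undefined)"

lemma space_history: "space (history t) = space (PiM {0..<t} (\<lambda>_. MXU))"
  and sets_history [measurable_cong]: "sets (history t) = sets (PiM {0..<t} (\<lambda>_. MXU))"
  using space_C[of "\<lambda>_. undefined" 0 t] sets_C[of "\<lambda>_. undefined" 0 t] by (simp_all add: space_PiM)

text \<open>Tower property: \<open>history (Suc t)\<close> arises from \<open>history t\<close> by
  appending at coordinate \<open>t\<close> a pair drawn from the step kernel, and given the history
  that pair is determined by its state.\<close>

lemma nn_integral_history_Suc:
  assumes f [measurable]: "f \<in> borel_measurable (PiM {0..<Suc t} (\<lambda>_. MXU))"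
  shows "(\<integral>\<^sup>+\<omega>. f \<omega> \<partial>history (Suc t)) =
    (\<integral>\<^sup>+\<omega>. (\<integral>\<^sup>+x. f (fun_upd \<omega> t (x, act t \<omega> x)) \<partial>state_law t \<omega>) \<partial>history t)"
proof -
  have "(\<integral>\<^sup>+\<omega>. f \<omega> \<partial>history (Suc t)) = (\<integral>\<^sup>+\<omega>. (\<integral>\<^sup>+\<omega>'. f \<omega>' \<partial>eP t \<omega>) \<partial>history t)"
    by (simp add: nn_integral_bind[where B="PiM {0..<Suc t} (\<lambda>_. MXU)"])
  also have "\<dots> = (\<integral>\<^sup>+\<omega>. (\<integral>\<^sup>+x. f (fun_upd \<omega> t (x, act t \<omega> x)) \<partial>state_law t \<omega>) \<partial>history t)"
  proof (rule nn_integral_cong)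
    fix \<omega> assume "\<omega> \<in> space (history t)"
    then have w: "\<omega> \<in> space (PiM {0..<t} (\<lambda>_. MXU))" by (simp add: space_history)
    have m: "(\<lambda>z. f (fun_upd \<omega> t z)) \<in> borel_measurable MXU"
      by (rule measurable_compose[OF _ f], rule measurable_fun_upd[where J="{0..<t}"]) (use w in auto)
    note a = measurable_state_act[OF w]
    show "(\<integral>\<^sup>+\<omega>'. f \<omega>' \<partial>eP t \<omega>) = (\<integral>\<^sup>+x. f (fun_upd \<omega> t (x, act t \<omega> x)) \<partial>state_law t \<omega>)"
      by (simp add: nn_integral_eP[OF w f] step_kernel_eq nn_integral_distr[OF a] m)
  qed
  finally show ?thesis .
qed

text \<open>The Foster--Lyapunov telescoping argument; the last summand on the left is the
  conditional expectation of \<open>\<Phi>\<close> at the next state.\<close>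

lemma drift_history:
  fixes \<Phi> :: "'x \<Rightarrow> ennreal" and d :: "'x \<Rightarrow> 'u \<Rightarrow> ennreal"
  assumes [measurable]: "\<Phi> \<in> borel_measurable MX" "(\<lambda>(x, u). d x u) \<in> borel_measurable MXU"
    and drift: "\<And>t xs us. xs t \<in> space MX \<Longrightarrow> \<gamma> t xs us \<in> space MU \<Longrightarrow>
      d (xs t) (\<gamma> t xs us) + (\<integral>\<^sup>+x'. \<Phi> x' \<partial>T (xs t) (\<gamma> t xs us)) \<le> G + \<Phi> (xs t)"
  shows "(\<integral>\<^sup>+\<omega>. (\<Sum>s<t. d (fst (\<omega> s)) (snd (\<omega> s))) + (\<integral>\<^sup>+x. \<Phi> x \<partial>state_law t \<omega>) \<partial>history t)
    \<le> of_nat t * G + \<Phi> x0"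
proof (induction t)
  case 0
  show ?case
    using start prob_space.emeasure_space_1[OF prob_space_C[of "\<lambda>_. undefined" 0 0]]
    by (simp add: state_law_def nn_integral_return space_PiM del: C.simps)
next
  case (Suc t)
  let ?S = "\<lambda>t \<omega>. \<Sum>s<t. d (fst (\<omega> s)) (snd (\<omega> s))"
  have comp [measurable]: "(\<lambda>\<omega>. \<omega> s) \<in> PiM {0..<t} (\<lambda>_. MXU) \<rightarrow>\<^sub>M MXU" if "s < t" for s t :: nat
    using that by (intro measurable_component_singleton) auto
  have dm: "(\<lambda>\<omega>. d (fst (\<omega> s)) (snd (\<omega> s))) \<in> borel_measurable (PiM {0..<t} (\<lambda>_. MXU))" if "s < t" for s t :: nat
    using measurable_compose[OF comp[OF that] assms(2)] by (simp add: split_beta)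
  have S [measurable]: "?S t \<in> borel_measurable (PiM {0..<t} (\<lambda>_. MXU))" for t :: nat
    by (intro borel_measurable_sum dm) auto
  have P [measurable]: "(\<lambda>\<omega>. \<integral>\<^sup>+x. \<Phi> x \<partial>state_law t \<omega>) \<in> borel_measurable (PiM {0..<t} (\<lambda>_. MXU))" for t
    by measurable
  let ?f = "\<lambda>\<omega>. ?S (Suc t) \<omega> + (\<integral>\<^sup>+x. \<Phi> x \<partial>state_law (Suc t) \<omega>)"
  have "(\<integral>\<^sup>+\<omega>. ?f \<omega> \<partial>history (Suc t)) =
    (\<integral>\<^sup>+\<omega>. (\<integral>\<^sup>+x. ?f (fun_upd \<omega> t (x, act t \<omega> x)) \<partial>state_law t \<omega>) \<partial>history t)"
    by (rule nn_integral_history_Suc) measurable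
  \<comment> \<open>Given the history, one use of the drift trades the cost at time \<open>t\<close>
    and the expectation of \<open>\<Phi>\<close> at the following state for
    \<open>G + \<Phi>\<close>; the expectation of this \<open>\<Phi>\<close> is the one in the
    induction hypothesis.\<close>
  also have "\<dots> \<le> (\<integral>\<^sup>+\<omega>. ?S t \<omega> + (\<integral>\<^sup>+x. \<Phi> x \<partial>state_law t \<omega>) + G \<partial>history t)"
  proof (rule nn_integral_mono)
    fix \<omega> assume "\<omega> \<in> space (history t)"
    then have w: "\<omega> \<in> space (PiM {0..<t} (\<lambda>_. MXU))" by (simp add: space_history)
    interpret L: prob_space "state_law t \<omega>" by (rule prob_space_state_law[OF w])
    have [measurable]: "\<Phi> \<in> borel_measurable (state_law t \<omega>)"
      by (simp add: measurable_cong_sets[OF state_law_space(1)[OF w] refl])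
    have "(\<integral>\<^sup>+x. ?f (fun_upd \<omega> t (x, act t \<omega> x)) \<partial>state_law t \<omega>)
        \<le> (\<integral>\<^sup>+x. ?S t \<omega> + (G + \<Phi> x) \<partial>state_law t \<omega>)"
    proof (rule nn_integral_mono)
      fix x assume "x \<in> space (state_law t \<omega>)"
      then have x: "x \<in> space MX" by (simp add: state_law_space[OF w])
      then have u: "act t \<omega> x \<in> space MU" by (rule measurable_space[OF measurable_act_at[OF w]])
      \<comment> \<open>The restricted state history takes the value \<open>x\<close> at
        \<open>t\<close>, so the drift hypothesis at this history is about the action
        \<open>act t \<omega> x\<close>.\<close>
      have step: "d x (act t \<omega> x) + (\<integral>\<^sup>+x'. \<Phi> x' \<partial>T x (act t \<omega> x)) \<le> G + \<Phi> x"
        using drift[of "\<lambda>i\<in>{..t}. if i = t then x else fst (\<omega> i)" t "\<lambda>i\<in>{..<t}. snd (\<omega> i)"] x u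
        by (simp add: act_def)
      have "?f (fun_upd \<omega> t (x, act t \<omega> x)) =
          ?S t \<omega> + (d x (act t \<omega> x) + (\<integral>\<^sup>+x'. \<Phi> x' \<partial>T x (act t \<omega> x)))"
        by (simp add: state_law_def add.assoc)
      then show "?f (fun_upd \<omega> t (x, act t \<omega> x)) \<le> ?S t \<omega> + (G + \<Phi> x)"
        using add_left_mono[OF step] by (simp only:)
    qed
    also have "\<dots> = ?S t \<omega> + (\<integral>\<^sup>+x. \<Phi> x \<partial>state_law t \<omega>) + G"
      by (simp add: nn_integral_add L.emeasure_space_1 ac_simps)
    finally show "(\<integral>\<^sup>+x. ?f (fun_upd \<omega> t (x, act t \<omega> x)) \<partial>state_law t \<omega>)
      \<le> ?S t \<omega> + (\<integral>\<^sup>+x. \<Phi> x \<partial>state_law t \<omega>) + G" .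
  qed
  also have "\<dots> = (\<integral>\<^sup>+\<omega>. ?S t \<omega> + (\<integral>\<^sup>+x. \<Phi> x \<partial>state_law t \<omega>) \<partial>history t) + G"
    using prob_space.emeasure_space_1[OF prob_space_C[of "\<lambda>_. undefined" 0 t]]
    by (subst nn_integral_add) (auto simp: space_PiM)
  also have "\<dots> \<le> of_nat t * G + \<Phi> x0 + G"
    by (intro add_right_mono Suc.IH)
  finally show ?case by (simp add: algebra_simps)
qed

section \<open>Marginals of the trajectory measure\<close>

lemma trajectory_eq_lim: "trajectory_measure MX MU T \<gamma> x0 = PF.lim"
  by (simp add: trajectory_measure_def)

text \<open>The projective limit has the prescribed marginals, which on an initial segment are the
  histories; finite-horizon expectations can thus be computed under
  \<open>history t\<close>.\<close>

lemma distr_trajectory: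
  "distr (trajectory_measure MX MU T \<gamma> x0) (PiM {0..<t} (\<lambda>_. MXU)) (\<lambda>\<omega>. restrict \<omega> {0..<t}) = history t"
proof (rule measure_eqI)
  fix A assume "A \<in> sets (distr (trajectory_measure MX MU T \<gamma> x0) (PiM {0..<t} (\<lambda>_. MXU)) (\<lambda>\<omega>. restrict \<omega> {0..<t}))"
  then have A: "A \<in> sets (PiM {0..<t} (\<lambda>_. MXU))" by simp
  have "prod_emb {0..<t} (\<lambda>_. MXU) {0..<t} A = A"
    using sets.sets_into_space[OF A] by (intro prod_emb_id) (auto simp: space_PiM)
  then show "emeasure (distr (trajectory_measure MX MU T \<gamma> x0) (PiM {0..<t} (\<lambda>_. MXU)) (\<lambda>\<omega>. restrict \<omega> {0..<t})) A
      = emeasure (history t) A"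
    using A by (simp add: trajectory_eq_lim distr_lim emeasure_CI[of _ t])
qed (simp add: sets_history)

text \<open>The drift is required only at actions that the policy takes on some history, so it can
  hold for one well-chosen policy even if it fails for other actions.\<close>

lemma drift_trajectory:
  fixes \<Phi> :: "'x \<Rightarrow> ennreal" and d :: "'x \<Rightarrow> 'u \<Rightarrow> ennreal"
  assumes "\<Phi> \<in> borel_measurable MX" and d: "(\<lambda>(x, u). d x u) \<in> borel_measurable MXU"
    and "\<And>t xs us. xs t \<in> space MX \<Longrightarrow> \<gamma> t xs us \<in> space MU \<Longrightarrow>
      d (xs t) (\<gamma> t xs us) + (\<integral>\<^sup>+x'. \<Phi> x' \<partial>T (xs t) (\<gamma> t xs us)) \<le> G + \<Phi> (xs t)"
  shows "(\<integral>\<^sup>+\<omega>. (\<Sum>s<t. d (fst (\<omega> s)) (snd (\<omega> s))) \<partial>trajectory_measure MX MU T \<gamma> x0) \<le> of_nat t * G + \<Phi> x0"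
proof -
  let ?S = "\<lambda>\<omega>. \<Sum>s<t. d (fst (\<omega> s)) (snd (\<omega> s))"
  have "(\<lambda>\<omega>. \<omega> s) \<in> PiM {0..<t} (\<lambda>_. MXU) \<rightarrow>\<^sub>M MXU" if "s < t" for s
    using that by (intro measurable_component_singleton) auto
  from measurable_compose[OF this d]
  have S: "?S \<in> borel_measurable (PiM {0..<t} (\<lambda>_. MXU))"
    by (intro borel_measurable_sum) (auto simp: split_beta)
  have r: "(\<lambda>\<omega>. restrict \<omega> {0..<t}) \<in> trajectory_measure MX MU T \<gamma> x0 \<rightarrow>\<^sub>M PiM {0..<t} (\<lambda>_. MXU)"
    unfolding trajectory_eq_lim measurable_cong_sets[OF PF.sets_lim refl]
    by (rule measurable_restrict_subset) simp
  have "(\<integral>\<^sup>+\<omega>. ?S \<omega> \<partial>trajectory_measure MX MU T \<gamma> x0) =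
      (\<integral>\<^sup>+\<omega>. ?S (restrict \<omega> {0..<t}) \<partial>trajectory_measure MX MU T \<gamma> x0)"
    by (intro nn_integral_cong sum.cong) auto
  also have "\<dots> = (\<integral>\<^sup>+\<omega>. ?S \<omega> \<partial>history t)"
    by (subst distr_trajectory[symmetric], subst nn_integral_distr[OF r]) (use S in auto)
  also have "\<dots> \<le> (\<integral>\<^sup>+\<omega>. ?S \<omega> + (\<integral>\<^sup>+x. \<Phi> x \<partial>state_law t \<omega>) \<partial>history t)"
    by (intro nn_integral_mono) auto
  also have "\<dots> \<le> of_nat t * G + \<Phi> x0"
    using assms by (rule drift_history)
  finally show ?thesis .
qed

text \<open>Image measures keep the total mass, so the marginal on the empty index set is
  enough.\<close>

lemma prob_space_trajectory: "prob_space (trajectory_measure MX MU T \<gamma> x0)"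
proof -
  have "(\<lambda>\<omega>. restrict \<omega> {0..<0}) \<in> trajectory_measure MX MU T \<gamma> x0 \<rightarrow>\<^sub>M PiM {0..<0::nat} (\<lambda>_. MXU)"
    unfolding trajectory_eq_lim measurable_cong_sets[OF PF.sets_lim refl]
    by (rule measurable_restrict_subset) simp
  then show ?thesis
    by (rule prob_space_distrD, unfold distr_trajectory, intro prob_space_C) (simp add: space_PiM)
qed

lemma measurable_trajectory_cost:
  assumes d: "(\<lambda>(x, u). d x u) \<in> MXU \<rightarrow>\<^sub>M N"
  shows "(\<lambda>\<omega>. d (fst (\<omega> s)) (snd (\<omega> s))) \<in> trajectory_measure MX MU T \<gamma> x0 \<rightarrow>\<^sub>M N"
  unfolding trajectory_eq_lim measurable_cong_sets[OF PF.sets_lim refl]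
  using measurable_compose[OF measurable_component_singleton[of s UNIV "\<lambda>_. MXU"] d]
  by (simp add: split_beta)

lemma trajectory_in_space:
  assumes "\<omega> \<in> space (trajectory_measure MX MU T \<gamma> x0)"
  shows "fst (\<omega> s) \<in> space MX" "snd (\<omega> s) \<in> space MU"
proof -
  have "\<omega> s \<in> space MXU"
    using assms by (auto simp: trajectory_eq_lim space_PiM)
  then show "fst (\<omega> s) \<in> space MX" "snd (\<omega> s) \<in> space MU"
    by (auto simp: space_pair_measure)
qed

section \<open>Average cost bounds from drift inequalities\<close>

lemma expected_cost_le:
  fixes \<Phi> :: "'x \<Rightarrow> real" and d :: "'x \<Rightarrow> 'u \<Rightarrow> real"
  assumes \<Phi>: "\<Phi> \<in> borel_measurable MX" and \<Phi>0: "\<And>x. x \<in> space MX \<Longrightarrow> 0 \<le> \<Phi> x"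
    and int: "\<And>x u. x \<in> space MX \<Longrightarrow> u \<in> space MU \<Longrightarrow> integrable (T x u) \<Phi>"
    and d [measurable]: "(\<lambda>(x, u). d x u) \<in> borel_measurable MXU"
    and d0: "\<And>x u. x \<in> space MX \<Longrightarrow> u \<in> space MU \<Longrightarrow> 0 \<le> d x u"
    and drift: "\<And>t xs us. xs t \<in> space MX \<Longrightarrow> \<gamma> t xs us \<in> space MU \<Longrightarrow>
      d (xs t) (\<gamma> t xs us) + (LINT x'|T (xs t) (\<gamma> t xs us). \<Phi> x') \<le> G + \<Phi> (xs t)"
    and G: "0 \<le> G"
  shows "(LINT \<omega>|trajectory_measure MX MU T \<gamma> x0. (\<Sum>s<t. d (fst (\<omega> s)) (snd (\<omega> s)))) \<le> real t * G + \<Phi> x0"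
proof -
  let ?P = "trajectory_measure MX MU T \<gamma> x0"
  \<comment> \<open>The telescoping takes place in \<open>ennreal\<close>, where no integrability
    has to be tracked. Nonnegativity of \<open>d\<close>, \<open>\<Phi>\<close> and \<open>G\<close>
    brings the bound back to real integrals.\<close>
  have ennd: "(\<lambda>(x, u). ennreal (d x u)) \<in> borel_measurable MXU"
    using measurable_compose[OF d measurable_ennreal] by (simp add: split_beta)
  have "(\<integral>\<^sup>+\<omega>. (\<Sum>s<t. ennreal (d (fst (\<omega> s)) (snd (\<omega> s)))) \<partial>?P) \<le> of_nat t * ennreal G + ennreal (\<Phi> x0)"
  proof (rule drift_trajectory[OF _ ennd])
    show "(\<lambda>x. ennreal (\<Phi> x)) \<in> borel_measurable MX" using \<Phi> by simp
    fix t xs us assume x: "xs t \<in> space MX" and u: "\<gamma> t xs us \<in> space MU"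
    have sp: "space (T (xs t) (\<gamma> t xs us)) = space MX"
      by (rule sets_eq_imp_space_eq[OF sets_kernel[OF x u]])
    have "(\<integral>\<^sup>+x'. ennreal (\<Phi> x') \<partial>T (xs t) (\<gamma> t xs us)) = ennreal (LINT x'|T (xs t) (\<gamma> t xs us). \<Phi> x')"
      by (intro nn_integral_eq_integral int x u AE_I2) (simp add: sp \<Phi>0)
    moreover have "0 \<le> (LINT x'|T (xs t) (\<gamma> t xs us). \<Phi> x')"
      by (intro integral_nonneg_AE AE_I2) (simp add: sp \<Phi>0)
    ultimately show "ennreal (d (xs t) (\<gamma> t xs us)) + (\<integral>\<^sup>+x'. ennreal (\<Phi> x') \<partial>T (xs t) (\<gamma> t xs us))
        \<le> ennreal G + ennreal (\<Phi> (xs t))"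
      using drift[OF x u] d0[OF x u] \<Phi>0[OF x] G by (simp flip: ennreal_plus)
  qed
  moreover have "(\<integral>\<^sup>+\<omega>. (\<Sum>s<t. ennreal (d (fst (\<omega> s)) (snd (\<omega> s)))) \<partial>?P) =
      (\<integral>\<^sup>+\<omega>. ennreal (\<Sum>s<t. d (fst (\<omega> s)) (snd (\<omega> s))) \<partial>?P)"
    by (intro nn_integral_cong sum_ennreal) (simp add: d0 trajectory_in_space)
  moreover have "(LINT \<omega>|?P. (\<Sum>s<t. d (fst (\<omega> s)) (snd (\<omega> s)))) =
      enn2real (\<integral>\<^sup>+\<omega>. ennreal (\<Sum>s<t. d (fst (\<omega> s)) (snd (\<omega> s))) \<partial>?P)"
  proof (intro integral_eq_nn_integral AE_I2)
    show "(\<lambda>\<omega>. \<Sum>s<t. d (fst (\<omega> s)) (snd (\<omega> s))) \<in> borel_measurable ?P"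
      by (intro borel_measurable_sum measurable_trajectory_cost[OF d])
    show "0 \<le> (\<Sum>s<t. d (fst (\<omega> s)) (snd (\<omega> s)))" if "\<omega> \<in> space ?P" for \<omega>
      by (intro sum_nonneg d0 trajectory_in_space[OF that])
  qed
  moreover have "of_nat t * ennreal G + ennreal (\<Phi> x0) = ennreal (real t * G + \<Phi> x0)"
    using G \<Phi>0[OF start] by (simp add: ennreal_of_nat_eq_real_of_nat ennreal_mult ennreal_plus)
  ultimately show ?thesis
    using G \<Phi>0[OF start] by (simp add: enn2real_leI)
qed

text \<open>\<open>\<Phi>\<close> enters the telescoped bound only through its initial value, which
  division by the horizon removes in the limit.\<close>

lemma avg_cost_le:
  fixes \<Phi> :: "'x \<Rightarrow> real" and c :: "'x \<Rightarrow> 'u \<Rightarrow> real"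
  assumes "\<Phi> \<in> borel_measurable MX" "\<And>x. x \<in> space MX \<Longrightarrow> 0 \<le> \<Phi> x"
    and "\<And>x u. x \<in> space MX \<Longrightarrow> u \<in> space MU \<Longrightarrow> integrable (T x u) \<Phi>"
    and "(\<lambda>(x, u). c x u) \<in> borel_measurable MXU"
    and "\<And>x u. x \<in> space MX \<Longrightarrow> u \<in> space MU \<Longrightarrow> 0 \<le> c x u"
    and "\<And>t xs us. xs t \<in> space MX \<Longrightarrow> \<gamma> t xs us \<in> space MU \<Longrightarrow>
      c (xs t) (\<gamma> t xs us) + (LINT x'|T (xs t) (\<gamma> t xs us). \<Phi> x') \<le> G + \<Phi> (xs t)"
    and "0 \<le> G"
  shows "avg_cost MX MU T c x0 \<gamma> \<le> ereal G"
proof -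
  let ?E = "\<lambda>N. (LINT \<omega>|trajectory_measure MX MU T \<gamma> x0. (\<Sum>t<N. c (fst (\<omega> t)) (snd (\<omega> t))))"
  have "(\<lambda>N. ereal (G + \<Phi> x0 / real N)) \<longlonglongrightarrow> ereal (G + 0)"
    by (intro tendsto_intros tendsto_divide_0[OF tendsto_const] filterlim_real_sequentially
        filterlim_at_top_imp_at_infinity)
  then have "limsup (\<lambda>N. ereal (G + \<Phi> x0 / real N)) = ereal G"
    by (intro lim_imp_Limsup) auto
  moreover have "limsup (\<lambda>N. ereal (1 / real N * ?E N)) \<le> limsup (\<lambda>N. ereal (G + \<Phi> x0 / real N))"
  proof (rule Limsup_mono, rule eventually_sequentiallyI[of 1])
    fix N :: nat assume N: "1 \<le> N"
    have "?E N \<le> real N * G + \<Phi> x0"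
      using assms by (rule expected_cost_le)
    with N show "ereal (1 / real N * ?E N) \<le> ereal (G + \<Phi> x0 / real N)"
      by (simp add: field_simps)
  qed
  ultimately show ?thesis by (simp add: avg_cost_def)
qed

text \<open>\<open>expected_cost_le\<close> is applied to the complementary cost
  \<open>K - c\<close> with rate \<open>K - G\<close>; the complement keeps all quantities
  nonnegative while reversing the inequality.\<close>

lemma avg_cost_ge:
  fixes \<Phi> :: "'x \<Rightarrow> real" and c :: "'x \<Rightarrow> 'u \<Rightarrow> real"
  assumes \<Phi>: "\<Phi> \<in> borel_measurable MX" "\<And>x. x \<in> space MX \<Longrightarrow> 0 \<le> \<Phi> x"
      "\<And>x u. x \<in> space MX \<Longrightarrow> u \<in> space MU \<Longrightarrow> integrable (T x u) \<Phi>"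
    and c [measurable]: "(\<lambda>(x, u). c x u) \<in> borel_measurable MXU"
    and c0: "\<And>x u. x \<in> space MX \<Longrightarrow> u \<in> space MU \<Longrightarrow> 0 \<le> c x u"
    and cK: "\<And>x u. x \<in> space MX \<Longrightarrow> u \<in> space MU \<Longrightarrow> c x u \<le> K"
    and drift: "\<And>x u. x \<in> space MX \<Longrightarrow> u \<in> space MU \<Longrightarrow> G + (LINT x'|T x u. \<Phi> x') \<le> c x u + \<Phi> x"
    and G: "G \<le> K"
  shows "ereal G \<le> avg_cost MX MU T c x0 \<gamma>"
proof -
  let ?P = "trajectory_measure MX MU T \<gamma> x0"
  interpret P: prob_space ?P by (rule prob_space_trajectory)
  let ?E = "\<lambda>N. (LINT \<omega>|?P. (\<Sum>t<N. c (fst (\<omega> t)) (snd (\<omega> t))))"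
  have "(\<lambda>N. ereal (G - \<Phi> x0 / real N)) \<longlonglongrightarrow> ereal (G - 0)"
    by (intro tendsto_intros tendsto_divide_0[OF tendsto_const] filterlim_real_sequentially
        filterlim_at_top_imp_at_infinity)
  then have "limsup (\<lambda>N. ereal (G - \<Phi> x0 / real N)) = ereal G"
    by (intro lim_imp_Limsup) auto
  moreover have "limsup (\<lambda>N. ereal (G - \<Phi> x0 / real N)) \<le> limsup (\<lambda>N. ereal (1 / real N * ?E N))"
  proof (rule Limsup_mono, rule eventually_sequentiallyI[of 1])
    fix N :: nat assume N: "1 \<le> N"
    have "(LINT \<omega>|?P. (\<Sum>t<N. K - c (fst (\<omega> t)) (snd (\<omega> t)))) \<le> real N * (K - G) + \<Phi> x0"
    proof (rule expected_cost_le[where d="\<lambda>x u. K - c x u", OF \<Phi>])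
      have "(\<lambda>z. K - (case z of (x, u) \<Rightarrow> c x u)) \<in> borel_measurable MXU"
        by (rule borel_measurable_diff[OF _ c]) simp
      then show "(\<lambda>(x, u). K - c x u) \<in> borel_measurable MXU"
        by (simp add: split_beta)
      show "0 \<le> K - c x u" if "x \<in> space MX" "u \<in> space MU" for x u
        using cK[OF that] by simp
      show "K - c (xs t) (\<gamma> t xs us) + (LINT x'|T (xs t) (\<gamma> t xs us). \<Phi> x') \<le> K - G + \<Phi> (xs t)"
        if "xs t \<in> space MX" "\<gamma> t xs us \<in> space MU" for t xs us
        using drift[OF that] by simp
      show "0 \<le> K - G" using G by simp
    qed
    moreover have int: "integrable ?P (\<lambda>\<omega>. c (fst (\<omega> t)) (snd (\<omega> t)))" for t
    proof (rule P.integrable_const_bound[of _ K])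
      show "AE \<omega> in ?P. norm (c (fst (\<omega> t)) (snd (\<omega> t))) \<le> K"
        by (intro AE_I2) (simp add: c0 cK trajectory_in_space)
    qed (rule measurable_trajectory_cost[OF c])
    ultimately have "real N * K - ?E N \<le> real N * (K - G) + \<Phi> x0"
      by (simp add: sum_subtractf P.prob_space)
    then have "real N * (G - \<Phi> x0 / real N) \<le> real N * (1 / real N * ?E N)"
      using N by (simp add: right_diff_distrib)
    with N show "ereal (G - \<Phi> x0 / real N) \<le> ereal (1 / real N * ?E N)"
      by (simp add: mult_le_cancel_left_pos del: times_divide_eq_left times_divide_eq_right)
  qed
  ultimately show ?thesis by (simp add: avg_cost_def)
qed

end

section \<open>Coverings in the l1 norm\<close>

lemma l1_norm_nonneg [simp]: "0 \<le> l1_norm x"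
  by (simp add: l1_norm_def sum_nonneg)

lemma l1_norm_zero [simp]: "l1_norm 0 = 0"
  by (simp add: l1_norm_def)

lemma l1_norm_eq_0_iff [simp]: "l1_norm x = 0 \<longleftrightarrow> x = 0"
  by (simp add: l1_norm_def sum_nonneg_eq_0_iff vec_eq_iff)

lemma l1_norm_minus_commute: "l1_norm (x - y) = l1_norm (y - x)"
  by (simp add: l1_norm_def abs_minus_commute)

lemma l1_norm_triangle: "l1_norm (x + y) \<le> l1_norm x + l1_norm y"
  by (simp add: l1_norm_def abs_triangle_ineq sum_mono flip: sum.distrib)

lemma l1_norm_triangle_diff: "l1_norm (x - z) \<le> l1_norm (x - y) + l1_norm (y - z)"
  using l1_norm_triangle[of "x - y" "y - z"] by simp

lemma l1_norm_diff_le: "l1_norm (x - y) \<le> l1_norm x + l1_norm y"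
  using l1_norm_triangle_diff[of x y 0] l1_norm_minus_commute[of 0 y] by simp

lemma l1_norm_scaleR: "l1_norm (a *\<^sub>R x) = \<bar>a\<bar> * l1_norm x"
  by (simp add: l1_norm_def abs_mult sum_distrib_left)

lemma continuous_on_l1_norm [continuous_intros]:
  "continuous_on A f \<Longrightarrow> continuous_on A (\<lambda>x. l1_norm (f x))"
  unfolding l1_norm_def by (intro continuous_intros)

lemma norm_le_l1_norm: "norm x \<le> l1_norm x"
  unfolding l1_norm_def by (rule norm_le_l1_cart)

section \<open>Packings and nets by comparison of volumes\<close>

definition l1_ball :: "real ^ 'n \<Rightarrow> real \<Rightarrow> (real ^ 'n) set" where
  "l1_ball a r = {z. l1_norm (z - a) < r}"

lemma open_l1_ball: "open (l1_ball a r)"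
  unfolding l1_ball_def by (intro open_Collect_less continuous_intros)

lemma lmeasurable_l1_ball: "l1_ball a r \<in> lmeasurable"
proof (rule lmeasurable_open[OF _ open_l1_ball])
  show "bounded (l1_ball a r)"
  proof (rule boundedI)
    fix z assume "z \<in> l1_ball a r"
    then show "norm z \<le> r + norm a"
      using norm_le_l1_norm[of "z - a"] norm_triangle_ineq2[of z a] by (simp add: l1_ball_def)
  qed
qed

text \<open>The ball is an affine image of the unit ball. The volume of the unit ball never has to
  be computed: it is positive and cancels in the packing bound.\<close>

lemma measure_l1_ball:
  fixes a :: "real ^ 'n"
  assumes "r > 0"
  shows "measure lebesgue (l1_ball a r) = r ^ CARD('n) * measure lebesgue (l1_ball (0 :: real ^ 'n) 1)"
proof -
  have "z \<in> (\<lambda>x. r *\<^sub>R x + a) ` l1_ball 0 1" if "z \<in> l1_ball a r" for z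
    using that assms
    by (intro image_eqI[of _ _ "(1 / r) *\<^sub>R (z - a)"]) (simp_all add: l1_ball_def l1_norm_scaleR)
  then have "l1_ball a r = (\<lambda>x. r *\<^sub>R x + a) ` l1_ball 0 1"
    using assms by (auto simp: l1_ball_def l1_norm_scaleR)
  then show ?thesis
    using assms by (simp add: measure_lebesgue_affine)
qed

lemma measure_l1_ball_pos: "r > 0 \<Longrightarrow> 0 < measure lebesgue (l1_ball a r)"
proof -
  assume "r > 0"
  then have "a \<in> l1_ball a r" by (simp add: l1_ball_def)
  then have "\<not> negligible (l1_ball a r)"
    using open_l1_ball open_not_negligible by blast
  then show ?thesis
    using lmeasurable_l1_ball[of a r] by (simp add: zero_less_measure_iff negligible_iff_measure)
qed

text \<open>The balls of radius \<open>r/2\<close> around the points of \<open>S\<close> are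
  disjoint and lie in the ball of radius \<open>R + r/2\<close> around \<open>a\<close>; compare
  volumes.\<close>

lemma l1_packing_le:
  fixes S :: "(real ^ 'n) set"
  assumes "finite S" and S: "\<And>x. x \<in> S \<Longrightarrow> l1_norm (x - a) \<le> R"
    and sep: "\<And>x y. x \<in> S \<Longrightarrow> y \<in> S \<Longrightarrow> x \<noteq> y \<Longrightarrow> r \<le> l1_norm (x - y)"
    and "r > 0" "R \<ge> 0"
  shows "real (card S) \<le> (1 + 2 * R / r) ^ CARD('n)"
proof -
  let ?v = "measure lebesgue (l1_ball (0 :: real ^ 'n) 1)"
  have "disjnt (l1_ball x (r/2)) (l1_ball y (r/2))" if "x \<in> S" "y \<in> S" "x \<noteq> y" for x y
  proof -
    have False if "l1_norm (z - x) < r/2" "l1_norm (z - y) < r/2" for z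
      using that sep[OF \<open>x \<in> S\<close> \<open>y \<in> S\<close> \<open>x \<noteq> y\<close>] l1_norm_triangle_diff[of x y z]
        l1_norm_minus_commute[of x z] by simp
    then show ?thesis by (auto simp: disjnt_def l1_ball_def)
  qed
  then have "(\<Sum>x\<in>S. measure lebesgue (l1_ball x (r/2))) = measure lebesgue (\<Union>x\<in>S. l1_ball x (r/2))"
    using assms(1) lmeasurable_l1_ball
    by (intro measure_UNION'[symmetric]) (auto simp: pairwise_def)
  also have "\<dots> \<le> measure lebesgue (l1_ball a (R + r/2))"
  proof (rule measure_mono_fmeasurable[OF _ _ lmeasurable_l1_ball])
    have "l1_norm (z - a) < R + r/2" if "x \<in> S" "l1_norm (z - x) < r/2" for x z
      using that S[of x] l1_norm_triangle_diff[of z a x] by simp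
    then show "(\<Union>x\<in>S. l1_ball x (r/2)) \<subseteq> l1_ball a (R + r/2)"
      by (auto simp: l1_ball_def)
    show "(\<Union>x\<in>S. l1_ball x (r/2)) \<in> sets lebesgue"
      using assms(1) lmeasurable_l1_ball by (intro sets.finite_UN) (auto simp: fmeasurable_def)
  qed
  finally have "real (card S) * (r/2) ^ CARD('n) * ?v \<le> (R + r/2) ^ CARD('n) * ?v"
    using assms(4,5) by (simp add: measure_l1_ball[of "r/2"] measure_l1_ball[of "R + r/2"])
  then have "real (card S) * (r/2) ^ CARD('n) \<le> (R + r/2) ^ CARD('n)"
    using measure_l1_ball_pos[of 1 "0 :: real ^ 'n"] by simp
  then have "real (card S) \<le> ((R + r/2) / (r/2)) ^ CARD('n)"
    using assms(4) by (metis power_divide pos_le_divide_eq zero_less_power half_gt_zero)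
  also have "(R + r/2) / (r/2) = 1 + 2 * R / r"
    using assms(4) by (simp add: field_simps)
  finally show ?thesis .
qed

text \<open>Finitely many distances greater than \<open>r\<close> have a minimum that is still
  greater than \<open>r\<close>, which makes the packing bound strict. In dimension 1 this turns a
  count below M + 1 into one of at most M.\<close>

lemma l1_packing_less:
  fixes S :: "(real ^ 'n) set"
  assumes "finite S" and S: "\<And>x. x \<in> S \<Longrightarrow> l1_norm (x - a) \<le> R"
    and sep: "\<And>x y. x \<in> S \<Longrightarrow> y \<in> S \<Longrightarrow> x \<noteq> y \<Longrightarrow> r < l1_norm (x - y)"
    and "r > 0" "R > 0"
  shows "real (card S) < (1 + 2 * R / r) ^ CARD('n)"
proof -
  \<comment> \<open>The extra element \<open>r + 1\<close> makes the minimum well defined and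
    greater than \<open>r\<close> even if \<open>S\<close> has no two distinct points.\<close>
  define D where "D = insert (r + 1) ((\<lambda>(x, y). l1_norm (x - y)) ` {(x, y) \<in> S \<times> S. x \<noteq> y})"
  have fin: "finite D"
    unfolding D_def using assms(1)
    by (intro finite.insertI finite_imageI, rule_tac finite_subset[of _ "S \<times> S"]) auto
  have "r < Min D"
    using fin sep by (subst Min_gr_iff) (auto simp: D_def)
  moreover have "Min D \<le> l1_norm (x - y)" if "x \<in> S" "y \<in> S" "x \<noteq> y" for x y
    using that fin by (intro Min_le) (auto simp: D_def)
  ultimately have "real (card S) \<le> (1 + 2 * R / Min D) ^ CARD('n)"
    using assms by (intro l1_packing_le[of S a]) auto
  also have "\<dots> < (1 + 2 * R / r) ^ CARD('n)"
  proof (rule power_strict_mono)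
    show "1 + 2 * R / Min D < 1 + 2 * R / r"
      using \<open>r < Min D\<close> assms(4,5) by (simp add: frac_less2)
    show "0 \<le> 1 + 2 * R / Min D" using \<open>r < Min D\<close> assms(4,5) by simp
  qed simp
  finally show ?thesis .
qed

text \<open>A maximal \<open>r\<close>-separated set is an \<open>r\<close>-net, since a point
  farther than \<open>r\<close> from all of it could be added. Maximality is taken among sets
  containing \<open>z0\<close>, and the packing bound ensures that a largest one exists.\<close>

lemma l1_net_exists:
  fixes Z :: "(real ^ 'n) set"
  assumes Z: "\<And>x. x \<in> Z \<Longrightarrow> l1_norm (x - a) \<le> R" and "z0 \<in> Z" and r: "r > 0" and R: "R > 0"
  obtains S where "finite S" "S \<subseteq> Z" "z0 \<in> S" "real (card S) < (1 + 2 * R / r) ^ CARD('n)"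
    "\<And>z. z \<in> Z \<Longrightarrow> \<exists>s\<in>S. l1_norm (z - s) \<le> r"
proof -
  define sep where "sep S \<longleftrightarrow> finite S \<and> S \<subseteq> Z \<and> z0 \<in> S \<and>
    (\<forall>x\<in>S. \<forall>y\<in>S. x \<noteq> y \<longrightarrow> r < l1_norm (x - y))" for S
  have bound: "real (card S) < (1 + 2 * R / r) ^ CARD('n)" if "sep S" for S
    using that Z r R by (intro l1_packing_less[of S a]) (auto simp: sep_def)
  have "sep {z0}" using assms by (simp add: sep_def)
  moreover have "\<forall>S. sep S \<longrightarrow> card S < Suc (nat \<lceil>(1 + 2 * R / r) ^ CARD('n)\<rceil>)"
    using bound by (meson less_Suc_eq_le less_imp_le of_nat_le_iff order_trans real_nat_ceiling_ge)
  ultimately obtain S where S: "sep S" and max: "\<And>S'. sep S' \<Longrightarrow> card S' \<le> card S"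
    using ex_has_greatest_nat[of sep "{z0}" card] by blast
  show thesis
  proof
    show "finite S" "S \<subseteq> Z" "z0 \<in> S" "real (card S) < (1 + 2 * R / r) ^ CARD('n)"
      using S bound[OF S] by (auto simp: sep_def)
    fix z assume z: "z \<in> Z"
    show "\<exists>s\<in>S. l1_norm (z - s) \<le> r"
    proof (rule ccontr)
      assume "\<not> (\<exists>s\<in>S. l1_norm (z - s) \<le> r)"
      then have far: "r < l1_norm (z - s)" if "s \<in> S" for s using that by force
      then have "z \<notin> S" using r by force
      moreover have "sep (insert z S)"
        using S z far by (auto simp: sep_def l1_norm_minus_commute[of _ z])
      ultimately show False using max[of "insert z S"] S by (simp add: sep_def)
    qed
  qed
qed

text \<open>In dimension 1 the bound leaves no room for the comparison with \<open>y0\<close> on top of a \<open>2 * D\<close>-net.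
  If the ball of radius \<open>R\<close> meets \<open>X\<close> on both sides of 0, a point outside the ball is compared with one
  on its own side, and otherwise only half of the ball has to be covered.\<close>

lemma finite_cover_exists:
  fixes X :: "(real ^ 'n) set" and m \<beta> :: real and M :: nat
  assumes m: "m > 1" and \<beta>: "\<beta> > 0" and M: "M \<ge> 1" and y0: "y0 \<in> X" "l1_norm y0 \<le> \<beta>"
  obtains S A B where "finite S" "S \<subseteq> X" "S \<noteq> {}" "card S \<le> M" "0 \<le> A" "0 \<le> B"
    "A + B * \<beta> powr m \<le>
      (2 * real CARD('n) + 1) * \<beta> / real M powr (1 / real CARD('n) * (1 - 1 / m))"
    "\<And>x. x \<in> X \<Longrightarrow> \<exists>s\<in>S. l1_norm (x - s) \<le> A + B * l1_norm x powr m"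
proof -
  note cover = that
  let ?n = "CARD('n)"
  \<comment> \<open>\<open>t\<close> is the number of points available per dimension. The radius
    \<open>R\<close> balances two errors: the resolution \<open>D = R / t\<close> inside the ball,
    and the tail, where \<open>l1_norm x \<le> K * l1_norm x powr m\<close> and the weight
    \<open>K\<close> costs \<open>K * \<beta> powr m = D\<close> as well.\<close>
  define t where "t = real M powr (1 / real ?n)"
  define R where "R = \<beta> * t powr (1 / m)"
  define D where "D = R / t"
  define K where "K = 1 / R powr (m - 1)"
  have t1: "t \<ge> 1" using M by (simp add: t_def ge_one_powr_ge_zero)
  have tn: "t ^ ?n = real M"
    using M by (simp add: t_def flip: powr_realpow add: powr_powr)
  have R\<beta>: "\<beta> \<le> R" using \<beta> t1 m by (simp add: R_def ge_one_powr_ge_zero)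
  have pos: "R > 0" "D > 0" "K > 0" using R\<beta> \<beta> t1 by (auto simp: D_def K_def)
  have RtD: "R = t * D" using t1 by (simp add: D_def)
  have D_eq: "D = \<beta> / real M powr (1 / real ?n * (1 - 1 / m))"
  proof -
    have "real M powr (1 / real ?n * (1 - 1 / m)) = t powr (1 - 1 / m)"
      by (simp add: t_def powr_powr)
    also have "\<dots> = t / t powr (1 / m)"
      using t1 by (simp add: powr_diff)
    finally show ?thesis using t1 by (simp add: D_def R_def)
  qed
  have K\<beta>: "K * \<beta> powr m = D"
  proof -
    have "R powr (m - 1) = \<beta> powr (m - 1) * t powr (1 - 1 / m)"
      using \<beta> t1 m by (simp add: R_def powr_mult powr_powr field_simps)
    moreover have "\<beta> powr m = \<beta> * \<beta> powr (m - 1)"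
      using \<beta> by (simp add: powr_mult_base)
    moreover have "t powr (1 - 1 / m) = t / t powr (1 / m)"
      using t1 by (simp add: powr_diff)
    ultimately show ?thesis using \<beta> t1 by (simp add: K_def D_def R_def field_simps)
  qed
  have tail: "l1_norm x \<le> K * l1_norm x powr m" if "l1_norm x > R" for x :: "real ^ 'n"
  proof -
    have "l1_norm x * R powr (m - 1) \<le> l1_norm x * l1_norm x powr (m - 1)"
      using that pos m by (intro mult_left_mono powr_mono2) auto
    also have "\<dots> = l1_norm x powr m"
      using that pos by (simp add: powr_mult_base)
    finally show ?thesis using pos by (simp add: K_def field_simps)
  qed
  have \<beta>4: "\<beta> \<le> 4 * D" if "t \<le> 4"
  proof -
    have "t * D \<le> 4 * D" using that pos by (intro mult_right_mono) auto
    with R\<beta> show ?thesis by (simp add: RtD)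
  qed
  define Z where "Z = {x \<in> X. l1_norm x \<le> R}"
  have y0Z: "y0 \<in> Z" using y0 R\<beta> by (simp add: Z_def)
  have far: "l1_norm (x - y0) \<le> l1_norm x + \<beta>" for x
    using l1_norm_diff_le[of x y0] y0 by simp
  \<comment> \<open>The target allows \<open>2n + 1\<close> multiples of \<open>D\<close>. A radius
    \<open>A\<close> inside the ball and an error \<open>A + k * l1_norm x\<close> outside cost
    \<open>A + k * D\<close>, because \<open>tail\<close> and \<open>K\<beta>\<close> price
    \<open>l1_norm x\<close> at \<open>D\<close>.\<close>
  have net: thesis
    if S: "finite S" "S \<subseteq> Z" "S \<noteq> {}" "card S \<le> M"
      and A: "0 \<le> A" "0 \<le> k" "A + k * D \<le> (2 * real ?n + 1) * D"
      and inner: "\<And>z. z \<in> Z \<Longrightarrow> \<exists>s\<in>S. l1_norm (z - s) \<le> A"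
      and outer: "\<And>x. x \<in> X \<Longrightarrow> l1_norm x > R \<Longrightarrow> \<exists>s\<in>S. l1_norm (x - s) \<le> A + k * l1_norm x"
    for S A k
  proof (rule cover[of S A "k * K"])
    show "finite S" "S \<noteq> {}" "card S \<le> M" "0 \<le> A" using S A by auto
    show "S \<subseteq> X" using S by (auto simp: Z_def)
    show "0 \<le> k * K" using A pos by simp
    have "k * K * \<beta> powr m = k * D" using K\<beta> by simp
    then show "A + k * K * \<beta> powr m \<le> (2 * real ?n + 1) * \<beta> / real M powr (1 / real ?n * (1 - 1 / m))"
      using A(3) by (simp add: D_eq)
    fix x assume x: "x \<in> X"
    show "\<exists>s\<in>S. l1_norm (x - s) \<le> A + k * K * l1_norm x powr m"
    proof (cases "l1_norm x \<le> R")
      case True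
      moreover have "0 \<le> k * K * l1_norm x powr m" using A pos by simp
      ultimately show ?thesis using inner[of x] x by (force simp: Z_def)
    next
      case False
      then obtain s where "s \<in> S" "l1_norm (x - s) \<le> A + k * l1_norm x"
        using outer[OF x] by auto
      moreover have "k * l1_norm x \<le> k * (K * l1_norm x powr m)"
        using A False by (intro mult_left_mono tail) auto
      ultimately show ?thesis by (force simp: mult.assoc)
    qed
  qed
  \<comment> \<open>With \<open>n \<ge> 2\<close> at least \<open>5 * D\<close> may be spent:
    \<open>4 + 1\<close> if \<open>t < 4\<close>, where \<open>\<beta> \<le> 4 * D\<close> makes
    \<open>y0\<close> close enough for \<open>k = 1\<close>, and \<open>3 + 2\<close> otherwise,
    where \<open>\<beta> \<le> R < l1_norm x\<close> gives \<open>k = 2\<close>. In dimension 1 only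
    \<open>3 * D\<close> is available.\<close>
  consider (one) "?n = 1" | (small) "?n \<ge> 2" "t < 2" | (medium) "?n \<ge> 2" "2 \<le> t" "t < 4"
    | (large) "?n \<ge> 2" "4 \<le> t"
    by (metis One_nat_def Suc_1 Suc_leI linorder_neqE_nat not_less zero_less_card_finite less_one)
  then show thesis
  proof cases
    case small
    show ?thesis
    proof (rule net[of "{y0}" "4 * D" 1])
      show "4 * D + 1 * D \<le> (2 * real ?n + 1) * D"
        using small pos by (simp flip: distrib_right)
      fix z assume "z \<in> Z"
      then have "l1_norm (z - y0) \<le> 2 * R" using far[of z] R\<beta> by (simp add: Z_def)
      also have "\<dots> \<le> 4 * D" using small pos by (simp add: RtD)
      finally show "\<exists>s\<in>{y0}. l1_norm (z - s) \<le> 4 * D" by simp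
    next
      fix x assume "x \<in> X"
      have "\<beta> \<le> 4 * D" using small by (intro \<beta>4) auto
      then show "\<exists>s\<in>{y0}. l1_norm (x - s) \<le> 4 * D + 1 * l1_norm x"
        using far[of x] by simp
    qed (use y0Z M pos in auto)
  next
    case medium
    obtain S where S: "finite S" "S \<subseteq> Z" "y0 \<in> S" "real (card S) < (1 + 2 * R / (4 * D)) ^ ?n"
      "\<And>z. z \<in> Z \<Longrightarrow> \<exists>s\<in>S. l1_norm (z - s) \<le> 4 * D"
      using pos y0Z by (rule_tac l1_net_exists[of Z 0 R y0 "4 * D"]) (auto simp: Z_def)
    \<comment> \<open>By \<open>R = t * D\<close> the left side is \<open>1 + t / 2\<close>, so
      \<open>t \<ge> 2\<close> keeps the net within \<open>t ^ n = M\<close> points.\<close>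
    have "1 + 2 * R / (4 * D) \<le> t" using medium pos by (simp add: RtD)
    then have "(1 + 2 * R / (4 * D)) ^ ?n \<le> t ^ ?n" using pos by (intro power_mono) auto
    then have card: "card S \<le> M" using S(4) tn by simp
    show ?thesis
    proof (rule net[of S "4 * D" 1])
      show "4 * D + 1 * D \<le> (2 * real ?n + 1) * D"
        using medium pos by (simp flip: distrib_right)
      fix x assume "x \<in> X"
      have "\<beta> \<le> 4 * D" using medium by (intro \<beta>4) auto
      then have "l1_norm (x - y0) \<le> 4 * D + 1 * l1_norm x"
        using far[of x] by simp
      with S(3) show "\<exists>s\<in>S. l1_norm (x - s) \<le> 4 * D + 1 * l1_norm x" ..
    next
      show "S \<noteq> {}" using S(3) by blast
      show "0 \<le> 4 * D" using pos by simp
    qed (fact S(1) S(2) S(5) card | simp)+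
  next
    case large
    obtain S where S: "finite S" "S \<subseteq> Z" "y0 \<in> S" "real (card S) < (1 + 2 * R / (3 * D)) ^ ?n"
      "\<And>z. z \<in> Z \<Longrightarrow> \<exists>s\<in>S. l1_norm (z - s) \<le> 3 * D"
      using pos y0Z by (rule_tac l1_net_exists[of Z 0 R y0 "3 * D"]) (auto simp: Z_def)
    \<comment> \<open>Here the left side is \<open>1 + 2 * t / 3\<close>, which is at most
      \<open>t\<close> as soon as \<open>t \<ge> 3\<close>.\<close>
    have "1 + 2 * R / (3 * D) \<le> t" using large pos by (simp add: RtD)
    then have "(1 + 2 * R / (3 * D)) ^ ?n \<le> t ^ ?n" using pos by (intro power_mono) auto
    then have card: "card S \<le> M" using S(4) tn by simp
    show ?thesis
    proof (rule net[of S "3 * D" 2])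
      show "3 * D + 2 * D \<le> (2 * real ?n + 1) * D"
        using large pos by (simp flip: distrib_right)
      fix x assume "x \<in> X" "R < l1_norm x"
      then have "l1_norm (x - y0) \<le> 3 * D + 2 * l1_norm x"
        using far[of x] R\<beta> pos by linarith
      with S(3) show "\<exists>s\<in>S. l1_norm (x - s) \<le> 3 * D + 2 * l1_norm x" ..
    next
      show "S \<noteq> {}" using S(3) by blast
      show "0 \<le> 3 * D" using pos by simp
    qed (fact S(1) S(2) S(5) card | simp)+
  next
    case one
    then obtain k :: 'n where k: "(UNIV :: 'n set) = {k}" by (rule card_1_singletonE)
    have l1: "l1_norm x = \<bar>x $ k\<bar>" for x :: "real ^ 'n" unfolding l1_norm_def k by simp
    have tM: "t = real M" using tn one by simp
    show ?thesis
    proof (cases "(\<exists>p\<in>Z. p $ k \<ge> 0) \<and> (\<exists>p\<in>Z. p $ k \<le> 0)")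
      case True
      then obtain p1 p2 where p: "p1 \<in> Z" "p1 $ k \<ge> 0" "p2 \<in> Z" "p2 $ k \<le> 0" by blast
      obtain S where S: "finite S" "S \<subseteq> Z" "y0 \<in> S" "real (card S) < (1 + 2 * R / (2 * D)) ^ ?n"
        "\<And>z. z \<in> Z \<Longrightarrow> \<exists>s\<in>S. l1_norm (z - s) \<le> 2 * D"
        using pos y0Z by (rule_tac l1_net_exists[of Z 0 R y0 "2 * D"]) (auto simp: Z_def)
      \<comment> \<open>With \<open>R = t * D\<close> and \<open>t = M\<close> the strict packing
        bound reads \<open>card S < M + 1\<close>.\<close>
      have card: "card S \<le> M" using S(4) pos one tM by (simp add: RtD)
      show ?thesis
      proof (rule net[of S "2 * D" 1])
        fix x assume x: "x \<in> X" "R < l1_norm x"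
        define p where "p = (if x $ k \<ge> 0 then p1 else p2)"
        have "p \<in> Z" using p by (simp add: p_def)
        then obtain s where s: "s \<in> S" "l1_norm (p - s) \<le> 2 * D" using S(5) by blast
        \<comment> \<open>As \<open>p\<close> lies on the side of \<open>x\<close> and is closer to
          0, replacing \<open>x\<close> by \<open>p\<close> costs at most \<open>l1_norm x\<close>;
          the net then contributes \<open>2 * D\<close>.\<close>
        have "x $ k \<ge> 0 \<and> p $ k \<ge> 0 \<or> x $ k \<le> 0 \<and> p $ k \<le> 0"
          using p by (simp add: p_def)
        moreover have "\<bar>p $ k\<bar> \<le> R" "R < \<bar>x $ k\<bar>"
          using x \<open>p \<in> Z\<close> by (simp_all add: Z_def l1)
        ultimately have "l1_norm (x - p) \<le> l1_norm x"
          unfolding l1 vector_minus_component by arith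
        then have "l1_norm (x - s) \<le> 2 * D + 1 * l1_norm x"
          using s(2) l1_norm_triangle_diff[of x s p] by simp
        with s(1) show "\<exists>s\<in>S. l1_norm (x - s) \<le> 2 * D + 1 * l1_norm x" ..
      next
        show "S \<noteq> {}" using S(3) by blast
        show "0 \<le> 2 * D" using pos by simp
        show "2 * D + 1 * D \<le> (2 * real ?n + 1) * D" using one by simp
      qed (fact S(1) S(2) S(5) card | simp)+
    next
      case False
      \<comment> \<open>Now all of \<open>Z\<close> lies on one side of 0, and \<open>a\<close> is
        the centre of that half of the ball. The radius \<open>R / 2\<close> lets the same number of
        points achieve the finer net radius \<open>D\<close>, leaving \<open>2 * D\<close> for the
        comparison with \<open>y0\<close>.\<close>
      define e where "e = (if \<exists>p\<in>Z. p $ k \<ge> 0 then R / 2 else - R / 2)"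
      define a :: "real ^ 'n" where "a = (\<chi> i. e)"
      have "l1_norm (x - a) \<le> R / 2" if "x \<in> Z" for x
      proof -
        have "\<bar>x $ k\<bar> \<le> R" using that by (simp add: Z_def l1)
        moreover have "x $ k \<ge> 0 \<and> e = R / 2 \<or> x $ k \<le> 0 \<and> e = - R / 2"
          using False that unfolding e_def by (metis linear)
        ultimately show ?thesis
          unfolding l1 a_def vector_minus_component vec_lambda_beta by arith
      qed
      then obtain S where S: "finite S" "S \<subseteq> Z" "y0 \<in> S" "real (card S) < (1 + 2 * (R / 2) / D) ^ ?n"
        "\<And>z. z \<in> Z \<Longrightarrow> \<exists>s\<in>S. l1_norm (z - s) \<le> D"
        using pos y0Z by (rule_tac l1_net_exists[of Z a "R / 2" y0 D]) auto
      have card: "card S \<le> M" using S(4) pos one tM by (simp add: RtD)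
      show ?thesis
      proof (rule net[of S D 2])
        fix x assume "x \<in> X" "R < l1_norm x"
        then have "l1_norm (x - y0) \<le> D + 2 * l1_norm x"
          using far[of x] R\<beta> pos by linarith
        with S(3) show "\<exists>s\<in>S. l1_norm (x - s) \<le> D + 2 * l1_norm x" ..
      next
        show "S \<noteq> {}" using S(3) by blast
        show "0 \<le> D" using pos by simp
        show "D + 2 * D \<le> (2 * real ?n + 1) * D" using one by simp
      qed (fact S(1) S(2) S(5) card | simp)+
    qed
  qed
qed

text \<open>The covering is brought to exactly \<open>M\<close> points, and \<open>b = 0\<close> is
  included. There the target is 0 and an exact bound would need \<open>a \<le> 0\<close>, which
  fails when \<open>X\<close> accumulates at 0; hence the slack \<open>e\<close>. The set
  \<open>S\<close> is chosen before \<open>e\<close>.\<close>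

lemma exists_quantization_points:
  fixes X :: "(real ^ 'n) set" and m b :: real and M :: nat
  assumes m: "m > 1" and b: "b \<ge> 0" and M: "M \<ge> 1" "finite X \<longrightarrow> M \<le> card X"
    and y0: "y0 \<in> X" "l1_norm y0 powr m \<le> b"
  obtains S where "finite S" "S \<subseteq> X" "card S = M"
    "\<And>e. 0 < e \<Longrightarrow> \<exists>a k. 0 \<le> k \<and>
      a + k * b \<le> (2 * real CARD('n) + 1) * b powr (1 / m) / real M powr (1 / real CARD('n) * (1 - 1 / m)) + e \<and>
      (\<forall>x\<in>X. \<exists>s\<in>S. l1_norm (x - s) \<le> a + k * l1_norm x powr m)"
proof -
  let ?D = "(2 * real CARD('n) + 1) * b powr (1 / m) / real M powr (1 / real CARD('n) * (1 - 1 / m))"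
  let ?good = "\<lambda>S e. \<exists>a k. 0 \<le> k \<and> a + k * b \<le> ?D + e \<and>
      (\<forall>x\<in>X. \<exists>s\<in>S. l1_norm (x - s) \<le> a + k * l1_norm x powr m)"
  have "\<exists>S. finite S \<and> S \<subseteq> X \<and> card S \<le> M \<and> (\<forall>e>0. ?good S e)"
  proof (cases "b = 0")
    case True
    have y00: "y0 = 0" using y0(2) True by (simp add: powr_eq_0_iff)
    have "?good {y0} e" if e: "0 < e" for e
    \<comment> \<open>As \<open>k * b = 0\<close>, the factor \<open>k\<close> may grow without
      limit. Norms up to \<open>e\<close> are covered by \<open>a = e\<close>, and larger norms
      satisfy \<open>l1_norm x \<le> k * l1_norm x powr m\<close> with
      \<open>k = 1 / e powr (m - 1)\<close>.\<close>
    proof (rule exI[of _ e], rule exI[of _ "1 / e powr (m - 1)"], intro conjI ballI)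
      fix x :: "real ^ 'n"
      have "l1_norm x \<le> e + 1 / e powr (m - 1) * l1_norm x powr m"
      proof (cases "l1_norm x \<le> e")
        case True
        then show ?thesis using e by (simp add: add_increasing2)
      next
        case False
        then have "l1_norm x * e powr (m - 1) \<le> l1_norm x * l1_norm x powr (m - 1)"
          using e m by (intro mult_left_mono powr_mono2) auto
        also have "\<dots> = l1_norm x powr m"
          using e False by (simp add: powr_mult_base)
        finally have "l1_norm x \<le> 1 / e powr (m - 1) * l1_norm x powr m"
          using e by (simp add: field_simps)
        then show ?thesis using e by simp
      qed
      then show "\<exists>s\<in>{y0}. l1_norm (x - s) \<le> e + 1 / e powr (m - 1) * l1_norm x powr m"
        by (simp add: y00)
    qed (use True in auto)
    then show ?thesis using y0(1) M by (intro exI[of _ "{y0}"]) auto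
  next
    case False
    then have b0: "b > 0" using b by simp
    have "l1_norm y0 = (l1_norm y0 powr m) powr (1 / m)"
      using m by (simp add: powr_powr)
    also have "\<dots> \<le> b powr (1 / m)" using y0(2) m by (intro powr_mono2) auto
    finally have y0b: "l1_norm y0 \<le> b powr (1 / m)" .
    have bm: "(b powr (1 / m)) powr m = b" using m b0 by (simp add: powr_powr)
    obtain S A k where S: "finite S" "S \<subseteq> X" "card S \<le> M" and k: "0 \<le> k" "A + k * b \<le> ?D"
      and cover: "\<And>x. x \<in> X \<Longrightarrow> \<exists>s\<in>S. l1_norm (x - s) \<le> A + k * l1_norm x powr m"
      using b0 by (rule_tac finite_cover_exists[OF m _ M(1) y0(1) y0b, unfolded bm]) auto
    have "?good S e" if "0 < e" for e
    proof (rule exI[of _ A], rule exI[of _ k], intro conjI ballI)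
      show "A + k * b \<le> ?D + e" using k(2) that by linarith
    qed (fact k(1) cover)+
    then show ?thesis using S by blast
  qed
  then obtain S0 where S0: "finite S0" "S0 \<subseteq> X" "card S0 \<le> M" and good: "\<And>e. 0 < e \<Longrightarrow> ?good S0 e"
    by blast
  \<comment> \<open>Additional points preserve the cover; the assumption on finite \<open>X\<close>
    guarantees that there are enough of them.\<close>
  have "\<exists>S. S0 \<subseteq> S \<and> S \<subseteq> X \<and> finite S \<and> card S = M"
  proof (cases "finite X")
    case True
    then show ?thesis
      using exists_subset_between[OF S0(3) _ S0(2) True] M(2) finite_subset[OF _ True] by blast
  next
    case False
    then have "infinite (X - S0)" using S0(1) by simp
    then obtain Z where Z: "finite Z" "card Z = M - card S0" "Z \<subseteq> X - S0"
      using infinite_arbitrarily_large by blast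
    then have "card (S0 \<union> Z) = M" using S0 by (subst card_Un_disjoint) auto
    then show ?thesis using S0 Z by (intro exI[of _ "S0 \<union> Z"]) auto
  qed
  then obtain S where S: "S0 \<subseteq> S" "S \<subseteq> X" "finite S" "card S = M" by blast
  have "?good S e" if e: "0 < e" for e
  proof -
    obtain a k where "0 \<le> k" "a + k * b \<le> ?D + e"
      "\<forall>x\<in>X. \<exists>s\<in>S0. l1_norm (x - s) \<le> a + k * l1_norm x powr m"
      using good[OF e] by blast
    then show ?thesis using S(1) by blast
  qed
  then show thesis by (rule that[OF S(3) S(2) S(4)])
qed

section \<open>Finite models\<close>

text \<open>\<open>f / R\<close> is a test function of the total variation distance. The bound 2 on
  the test values makes the real-valued supremum a genuine upper bound, and for \<open>R = 0\<close>
  both integrals vanish.\<close>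

lemma integral_diff_le_tv_dist:
  assumes "prob_space P" "prob_space Q" and sets: "sets Q = sets P"
    and f [measurable]: "f \<in> borel_measurable P" and fR: "\<And>x. x \<in> space P \<Longrightarrow> \<bar>f x\<bar> \<le> R" and R: "0 \<le> R"
  shows "\<bar>(LINT x|P. f x) - (LINT x|Q. f x)\<bar> \<le> R * tv_dist P Q"
proof -
  interpret P: prob_space P by fact
  interpret Q: prob_space Q by fact
  have sp: "space Q = space P" using sets by (rule sets_eq_imp_space_eq)
  let ?F = "{f \<in> borel_measurable P. \<forall>x\<in>space P. \<bar>f x\<bar> \<le> (1::real)}"
  have le1: "\<bar>(LINT x|N. g x)\<bar> \<le> 1" if "prob_space N" "space N = space P" "g \<in> ?F" for g N
  proof -
    interpret N: prob_space N by fact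
    have "\<bar>(LINT x|N. g x)\<bar> \<le> (LINT x|N. \<bar>g x\<bar>)" by (rule integral_abs_bound)
    also have "\<dots> \<le> (LINT x|N. 1)"
      using that by (intro integral_mono') auto
    finally show ?thesis by (simp add: N.prob_space)
  qed
  have bdd: "bdd_above ((\<lambda>g. \<bar>(LINT x|P. g x) - (LINT x|Q. g x)\<bar>) ` ?F)"
    using le1[OF P.prob_space_axioms] le1[OF Q.prob_space_axioms sp] by (intro bdd_aboveI[of _ 2]) fastforce
  show ?thesis
  proof (cases "R = 0")
    case True
    then have "f x = 0" if "x \<in> space P" for x using fR[OF that] by simp
    then have "(LINT x|P. f x) = 0" "(LINT x|Q. f x) = 0"
      by (auto intro!: integral_eq_zero_AE AE_I2 simp: sp)
    then show ?thesis by (simp add: True)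
  next
    case False
    with R have pos: "R > 0" by simp
    have "(\<lambda>x. f x / R) \<in> ?F" using fR pos by (auto simp: field_simps)
    from cSUP_upper[OF this bdd]
    have "\<bar>(LINT x|P. f x) / R - (LINT x|Q. f x) / R\<bar> \<le> tv_dist P Q"
      by (simp add: tv_dist_def)
    then have "\<bar>(LINT x|P. f x) - (LINT x|Q. f x)\<bar> / R \<le> tv_dist P Q"
      using pos by (simp flip: diff_divide_distrib)
    then show ?thesis using pos by (simp add: field_simps)
  qed
qed

text \<open>Subtracting the minorizing measure \<open>\<nu>\<close> from the kernel turns the average cost optimality
  equation into a fixed point equation for a substochastic kernel, which is solved by monotone
  value iteration from 0.\<close>

lemma average_cost_optimality_equation:
  fixes S :: "'x set" and U :: "'u set" and c :: "'x \<Rightarrow> 'u \<Rightarrow> real"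
    and P :: "'x \<Rightarrow> 'u \<Rightarrow> 'x \<Rightarrow> real" and \<nu> :: "'x \<Rightarrow> real"
  assumes U: "finite U" "U \<noteq> {}"
    and P\<nu>: "\<And>s u s'. s \<in> S \<Longrightarrow> u \<in> U \<Longrightarrow> s' \<in> S \<Longrightarrow> \<nu> s' \<le> P s u s'"
    and \<nu>0: "\<And>s. s \<in> S \<Longrightarrow> 0 \<le> \<nu> s"
    and P1: "\<And>s u. s \<in> S \<Longrightarrow> u \<in> U \<Longrightarrow> (\<Sum>s'\<in>S. P s u s') = 1"
    and \<nu>\<delta>: "(\<Sum>s\<in>S. \<nu> s) = \<delta>" and \<delta>: "0 < \<delta>"
    and c0: "\<And>s u. s \<in> S \<Longrightarrow> u \<in> U \<Longrightarrow> 0 \<le> c s u"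
    and cK: "\<And>s u. s \<in> S \<Longrightarrow> u \<in> U \<Longrightarrow> c s u \<le> K"
    and K: "0 \<le> K"
  obtains g H where "0 \<le> g" "g \<le> K"
    "\<And>s. s \<in> S \<Longrightarrow> 0 \<le> H s" "\<And>s. s \<in> S \<Longrightarrow> H s \<le> K / \<delta>"
    "\<And>s u. s \<in> S \<Longrightarrow> u \<in> U \<Longrightarrow> g + H s \<le> c s u + (\<Sum>s'\<in>S. P s u s' * H s')"
    "\<And>s. s \<in> S \<Longrightarrow> \<exists>u\<in>U. g + H s = c s u + (\<Sum>s'\<in>S. P s u s' * H s')"
proof -
  define Q where "Q s u h = c s u + (\<Sum>s'\<in>S. (P s u s' - \<nu> s') * h s')" for s u and h :: "'x \<Rightarrow> real"
  define F where "F h s = Min ((\<lambda>u. Q s u h) ` U)" for h s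
  define h where "h k = (F ^^ k) (\<lambda>_. 0)" for k
  have h_Suc: "h (Suc k) = F (h k)" for k by (simp add: h_def)
  have F_le: "F h s \<le> Q s u h" if "u \<in> U" for h s u
    using U that by (simp add: F_def)
  have F_ex: "\<exists>u\<in>U. F h s = Q s u h" for h s
  proof -
    have "Min ((\<lambda>u. Q s u h) ` U) \<in> (\<lambda>u. Q s u h) ` U" using U by (intro Min_in) auto
    then show ?thesis unfolding F_def by (rule imageE) blast
  qed
  have P\<nu>0: "0 \<le> P s u s' - \<nu> s'" if "s \<in> S" "u \<in> U" "s' \<in> S" for s u s'
    using P\<nu>[OF that] by simp
  have Q_mono: "Q s u h1 \<le> Q s u h2"
    if "s \<in> S" "u \<in> U" "\<And>s'. s' \<in> S \<Longrightarrow> h1 s' \<le> h2 s'" for s u h1 h2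
    unfolding Q_def by (intro add_left_mono sum_mono mult_left_mono P\<nu>0 that)
  have F_mono: "F h1 s \<le> F h2 s"
    if "s \<in> S" "\<And>s'. s' \<in> S \<Longrightarrow> h1 s' \<le> h2 s'" for s h1 h2
  proof -
    obtain u where "u \<in> U" "F h2 s = Q s u h2" using F_ex by blast
    then show ?thesis using order_trans[OF F_le Q_mono[of s u h1 h2]] that by simp
  qed
  have bounds: "0 \<le> h k s \<and> h k s \<le> K / \<delta>" if "s \<in> S" for k s
    using that
  proof (induction k arbitrary: s)
    case 0
    then show ?case using K \<delta> by (simp add: h_def)
  next
    case (Suc k)
    obtain u where u: "u \<in> U" "h (Suc k) s = Q s u (h k)" using F_ex by (auto simp: h_Suc)
    have "0 \<le> (\<Sum>s'\<in>S. (P s u s' - \<nu> s') * h k s')"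
      using Suc.IH by (intro sum_nonneg mult_nonneg_nonneg P\<nu>0 Suc.prems u(1)) auto
    moreover have "(\<Sum>s'\<in>S. (P s u s' - \<nu> s') * h k s') \<le> (\<Sum>s'\<in>S. (P s u s' - \<nu> s') * (K / \<delta>))"
      using Suc.IH by (intro sum_mono mult_left_mono P\<nu>0 Suc.prems u(1)) auto
    \<comment> \<open>The kernel \<open>P - \<nu>\<close> has mass \<open>1 - \<delta>\<close>, and
      \<open>K / \<delta>\<close> is the level that reproduces itself:
      \<open>K + (1 - \<delta>) * (K / \<delta>) = K / \<delta>\<close>.\<close>
    moreover have "(\<Sum>s'\<in>S. (P s u s' - \<nu> s') * (K / \<delta>)) = K / \<delta> - K"
      using P1[OF Suc.prems u(1)] \<nu>\<delta> \<delta>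
      by (simp only: sum_subtractf left_diff_distrib sum_distrib_right[symmetric]) (simp add: field_simps)
    ultimately show ?case using u c0[OF Suc.prems u(1)] cK[OF Suc.prems u(1)] by (simp add: Q_def)
  qed
  have "h k s \<le> h (Suc k) s" if "s \<in> S" for k s
    using that
  proof (induction k arbitrary: s)
    case 0
    then show ?case using bounds[of s 1] by (simp add: h_def)
  next
    case (Suc k)
    then show ?case unfolding h_Suc[of "Suc k"] h_Suc[of k] using F_mono h_Suc by metis
  qed
  then have inc: "incseq (\<lambda>k. h k s)" if "s \<in> S" for s
    using that by (intro incseq_SucI)
  have "\<exists>L. (\<lambda>k. h k s) \<longlonglongrightarrow> L \<and> (\<forall>k. h k s \<le> L)" if "s \<in> S" for s
  proof (rule incseq_convergent[OF inc[OF that], of "K / \<delta>"])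
    show "\<forall>k. h k s \<le> K / \<delta>" using bounds[OF that] by blast
  qed blast
  then obtain H where lim: "\<And>s. s \<in> S \<Longrightarrow> (\<lambda>k. h k s) \<longlonglongrightarrow> H s"
    and hH: "\<And>s k. s \<in> S \<Longrightarrow> h k s \<le> H s"
    using bchoice[of S "\<lambda>s L. (\<lambda>k. h k s) \<longlonglongrightarrow> L \<and> (\<forall>k. h k s \<le> L)"] by blast
  have H0: "0 \<le> H s" if "s \<in> S" for s using bounds[OF that, of 0] hH[OF that, of 0] by simp
  have HK: "H s \<le> K / \<delta>" if "s \<in> S" for s
    using bounds[OF that] by (intro LIMSEQ_le_const2[OF lim[OF that]]) auto
  have Qlim: "(\<lambda>k. Q s u (h k)) \<longlonglongrightarrow> Q s u H" if "s \<in> S" for s u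
    unfolding Q_def by (intro tendsto_intros lim)
  have H_le: "H s \<le> Q s u H" if "s \<in> S" "u \<in> U" for s u
  proof (rule LIMSEQ_le[OF LIMSEQ_Suc[OF lim[OF that(1)]] Qlim[OF that(1)]])
    show "\<exists>N. \<forall>k\<ge>N. h (Suc k) s \<le> Q s u (h k)"
      using F_le[OF that(2)] by (simp add: h_Suc)
  qed
  \<comment> \<open>Minimizing actions may vary along the iteration. If no action attained equality
    in the limit, the finitely many strict inequalities would all hold at one large
    \<open>k\<close>, pushing \<open>h (Suc k) s\<close> above its limit.\<close>
  have H_ex: "\<exists>u\<in>U. H s = Q s u H" if s: "s \<in> S" for s
  proof (rule ccontr)
    assume "\<not> (\<exists>u\<in>U. H s = Q s u H)"
    then have "\<forall>u\<in>U. H s < Q s u H" using H_le[OF s] by (metis less_eq_real_def)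
    then have "\<forall>u\<in>U. eventually (\<lambda>k. H s < Q s u (h k)) sequentially"
      using order_tendstoD(1)[OF Qlim[OF s]] by blast
    then have "eventually (\<lambda>k. \<forall>u\<in>U. H s < Q s u (h k)) sequentially"
      by (rule eventually_ball_finite[OF U(1)])
    then obtain k where "\<forall>u\<in>U. H s < Q s u (h k)"
      by (auto simp: eventually_sequentially)
    then have "H s < h (Suc k) s" using F_ex[of "h k" s] by (auto simp: h_Suc)
    then show False using hH[OF s, of "Suc k"] by simp
  qed
  \<comment> \<open>Restoring the part of the kernel that was subtracted adds the same constant for
    every state and action; this constant is the gain.\<close>
  define g where "g = (\<Sum>s\<in>S. \<nu> s * H s)"
  have Q_eq: "g + Q s u H = c s u + (\<Sum>s'\<in>S. P s u s' * H s')" for s u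
    by (simp add: Q_def g_def left_diff_distrib sum_subtractf)
  have "g \<le> (\<Sum>s\<in>S. \<nu> s * (K / \<delta>))"
    unfolding g_def by (intro sum_mono mult_left_mono HK \<nu>0)
  also have "\<dots> = K" using \<nu>\<delta> \<delta> by (simp flip: sum_distrib_right sum_divide_distrib)
  finally have gK: "g \<le> K" .
  have g0: "0 \<le> g" unfolding g_def by (intro sum_nonneg mult_nonneg_nonneg H0 \<nu>0)
  show thesis
  proof (rule that[of g H])
    show "g + H s \<le> c s u + (\<Sum>s'\<in>S. P s u s' * H s')" if "s \<in> S" "u \<in> U" for s u
      using H_le[OF that] Q_eq[of s u] by simp
    show "\<exists>u\<in>U. g + H s = c s u + (\<Sum>s'\<in>S. P s u s' * H s')" if "s \<in> S" for s
      using H_ex[OF that] Q_eq[of s] by metis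
  qed (fact g0 gK H0 HK)+
qed

section \<open>Nearest-point bins\<close>

lemma bin_index_eqI:
  assumes "quantizer X M B y \<pi>" "i < M" "x \<in> B i"
  shows "bin_index M B x = i"
  unfolding bin_index_def
proof (rule the_equality)
  fix j assume "j < M \<and> x \<in> B j"
  with assms show "j = i"
    by (auto simp: quantizer_def disjoint_family_on_def)
qed (use assms in auto)

text \<open>The weighting measure is uniform on the representatives, so that conditioning it on a bin
  gives the point mass at the representative.\<close>

lemma nearest_point_quantizer:
  fixes X S :: "(real ^ 'n) set"
  assumes S: "finite S" "S \<subseteq> X" "card S = M" and M: "M \<ge> 1"
  obtains B y \<pi> where "quantizer X M B y \<pi>" "y ` {..<M} = S"
    "\<And>i. i < M \<Longrightarrow> uniform_measure \<pi> (B i) = return (restrict_space borel X) (y i)"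
    "\<And>x s. x \<in> X \<Longrightarrow> s \<in> S \<Longrightarrow> l1_norm (x - quantize M B y x) \<le> l1_norm (x - s)"
proof -
  obtain y where y: "bij_betw y {..<M} S"
    using ex_bij_betw_nat_finite[OF S(1)] S(3) by (auto simp: atLeast0LessThan)
  then have inj: "inj_on y {..<M}" and yS: "y ` {..<M} = S" by (auto simp: bij_betw_def)
  let ?MX = "restrict_space borel X"
  let ?d = "\<lambda>x i. l1_norm (x - y i)"
  \<comment> \<open>Ties go to the smallest index, which makes the cells disjoint.\<close>
  define B where "B i = {x \<in> X. (\<forall>j<M. ?d x i \<le> ?d x j) \<and> (\<forall>j<i. ?d x i < ?d x j)}" for i
  have yX: "y i \<in> X" if "i < M" for i using that yS S(2) by auto
  \<comment> \<open>The representatives are distinct, so each lies in its own cell only; hence every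
    cell gets mass \<open>1 / M\<close> and conditioning on it leaves one atom.\<close>
  have yB: "y j \<in> B i \<longleftrightarrow> j = i" if "i < M" "j < M" for i j
  proof
    assume "y j \<in> B i"
    then have "?d (y j) i \<le> ?d (y j) j" using that by (auto simp: B_def)
    then have "y j = y i" using l1_norm_nonneg[of "y j - y i"] by (simp del: l1_norm_nonneg)
    then show "j = i" using inj that by (auto dest: inj_onD)
  next
    assume "j = i"
    have "0 < ?d (y i) k" if "k < i" for k
    proof -
      have "y i \<noteq> y k" using inj \<open>i < M\<close> that by (auto dest: inj_onD)
      then show ?thesis using l1_norm_nonneg[of "y i - y k"] by (simp add: less_le del: l1_norm_nonneg)
    qed
    then show "y j \<in> B i" using \<open>j = i\<close> yX that by (simp add: B_def)
  qed
  have Bsets: "B i \<in> sets ?MX" for i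
  proof -
    define d where "d j x = ?d x j" for j x
    have [measurable]: "d j \<in> borel_measurable borel" for j
      unfolding d_def by (intro borel_measurable_continuous_onI continuous_intros)
    have "{x. (\<forall>j<M. d i x \<le> d j x) \<and> (\<forall>j<i. d i x < d j x)} \<in> sets borel"
      by measurable
    then have "{x. (\<forall>j<M. ?d x i \<le> ?d x j) \<and> (\<forall>j<i. ?d x i < ?d x j)} \<in> sets borel"
      by (simp only: d_def)
    then show ?thesis
      unfolding sets_restrict_space by (rule rev_image_eqI) (auto simp: B_def)
  qed
  have BX: "\<exists>i<M. x \<in> B i" if "x \<in> X" for x
  proof -
    let ?min = "\<lambda>i. i < M \<and> (\<forall>j<M. ?d x i \<le> ?d x j)"
    have "{..<M} \<noteq> {}" using M by (simp add: lessThan_empty_iff)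
    then have ex: "\<exists>i. ?min i"
      using arg_min_if_finite[of "{..<M}" "?d x"] by (meson finite_lessThan lessThan_iff not_less)
    \<comment> \<open>The least minimizing index satisfies the strict inequalities of the tie
      rule.\<close>
    define i where "i = (LEAST i. ?min i)"
    have i: "?min i" unfolding i_def using ex by (rule LeastI_ex)
    have "?d x i < ?d x j" if "j < i" for j
    proof -
      have "\<not> ?min j" using that unfolding i_def by (rule not_less_Least)
      moreover have "j < M" using that i by simp
      ultimately obtain k where "k < M" "?d x k < ?d x j" by force
      then show ?thesis using i by (meson order_le_less_trans)
    qed
    with i that show ?thesis by (auto simp: B_def)
  qed
  define \<pi> where "\<pi> = distr (uniform_count_measure {..<M}) ?MX y"
  have y_meas: "y \<in> uniform_count_measure {..<M} \<rightarrow>\<^sub>M ?MX"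
    using yX by (auto simp: measurable_def space_uniform_count_measure sets_uniform_count_measure
        space_restrict_space)
  have e\<pi>: "emeasure \<pi> A = ennreal (card {j. j < M \<and> y j \<in> A} / M)" if "A \<in> sets ?MX" for A
  proof -
    have "emeasure \<pi> A = emeasure (uniform_count_measure {..<M}) {j. j < M \<and> y j \<in> A}"
      using that unfolding \<pi>_def
      by (subst emeasure_distr[OF y_meas]) (auto simp: space_uniform_count_measure intro!: arg_cong2[of _ _ _ _ emeasure])
    also have "\<dots> = ennreal (card {j. j < M \<and> y j \<in> A} / card {..<M})"
      by (rule emeasure_uniform_count_measure) auto
    finally show ?thesis by simp
  qed
  have \<pi>B: "emeasure \<pi> (B i) = ennreal (1 / M)" if "i < M" for i
  proof -
    have "{j. j < M \<and> y j \<in> B i} = {i}" using yB that by auto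
    then show ?thesis by (simp add: e\<pi>[OF Bsets])
  qed
  have Q: "quantizer X M B y \<pi>"
    unfolding quantizer_def
  proof (intro conjI allI impI)
    show "disjoint_family_on B {..<M}"
      unfolding disjoint_family_on_def
    proof (intro ballI impI)
      have "B i \<inter> B j = {}" if "i < j" "j < M" for i j
        using that by (fastforce simp: B_def)
      then show "B i \<inter> B j = {}" if "i \<in> {..<M}" "j \<in> {..<M}" "i \<noteq> j" for i j
        using that by (metis Int_commute lessThan_iff nat_neq_iff)
    qed
    have "B i \<subseteq> X" for i unfolding B_def by blast
    then show "(\<Union>i<M. B i) = X" using BX by blast
    show "\<pi> \<in> space (prob_algebra ?MX)"
      unfolding \<pi>_def space_prob_algebra using M lessThan_empty_iff[of M]
      by (auto intro!: prob_space.prob_space_distr[OF prob_space_uniform_count_measure y_meas])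
    show "0 < measure \<pi> (B i)" if "i < M" for i
      using \<pi>B[OF that] M by (simp add: measure_def)
  qed (use Bsets yB in auto)
  have cond: "uniform_measure \<pi> (B i) = return ?MX (y i)" if i: "i < M" for i
  proof (rule measure_eqI)
    show "sets (uniform_measure \<pi> (B i)) = sets (return ?MX (y i))" by (simp add: \<pi>_def)
    fix A assume "A \<in> sets (uniform_measure \<pi> (B i))"
    then have A: "A \<in> sets ?MX" by (simp add: \<pi>_def)
    have "emeasure (uniform_measure \<pi> (B i)) A = emeasure \<pi> (B i \<inter> A) / emeasure \<pi> (B i)"
      using A Bsets by (intro emeasure_uniform_measure) (auto simp: \<pi>_def)
    also have "emeasure \<pi> (B i \<inter> A) = ennreal (card {j. j < M \<and> y j \<in> B i \<inter> A} / M)"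
      using A Bsets by (intro e\<pi>) auto
    also have "{j. j < M \<and> y j \<in> B i \<inter> A} = (if y i \<in> A then {i} else {})"
      using yB i by auto
    finally show "emeasure (uniform_measure \<pi> (B i)) A = emeasure (return ?MX (y i)) A"
      using A M \<pi>B[OF i] by (auto simp: divide_ennreal)
  qed
  have near: "l1_norm (x - quantize M B y x) \<le> l1_norm (x - s)" if "x \<in> X" "s \<in> S" for x s
  proof -
    obtain i where "i < M" "x \<in> B i" using BX[OF \<open>x \<in> X\<close>] by blast
    moreover obtain j where "j < M" "s = y j" using \<open>s \<in> S\<close> yS by auto
    ultimately show ?thesis
      using bin_index_eqI[OF Q] by (auto simp: quantize_def B_def)
  qed
  show thesis using that[OF Q yS cond near] .
qed

section \<open>Quantization error\<close>

text \<open>\<open>f\<close> is kept abstract: it enters the error analysis only through the drift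
  and a bound \<open>a + k * f x\<close> on the quantization distance.\<close>

locale lyapunov_mdp =
  fixes X :: "(real ^ 'n) set" and U :: "'u::t2_space set"
    and T :: "real ^ 'n \<Rightarrow> 'u \<Rightarrow> (real ^ 'n) measure" and c :: "real ^ 'n \<Rightarrow> 'u \<Rightarrow> real"
    and V f :: "real ^ 'n \<Rightarrow> real" and \<mu> :: "(real ^ 'n) measure" and K \<alpha>c \<alpha>T b :: real
  assumes U: "finite U" "U \<noteq> {}"
    and kernel: "stochastic_kernel (restrict_space borel X) (restrict_space borel U) T"
    and c_meas: "\<And>u. u \<in> U \<Longrightarrow> (\<lambda>x. c x u) \<in> borel_measurable (restrict_space borel X)"
    and c_nonneg: "\<And>x u. x \<in> X \<Longrightarrow> u \<in> U \<Longrightarrow> 0 \<le> c x u"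
    and c_le: "\<And>x u. x \<in> X \<Longrightarrow> u \<in> U \<Longrightarrow> c x u \<le> K"
    and \<alpha>: "0 \<le> \<alpha>c" "0 \<le> \<alpha>T"
    and c_lipschitz: "\<And>x x' u. x \<in> X \<Longrightarrow> x' \<in> X \<Longrightarrow> u \<in> U \<Longrightarrow> \<bar>c x u - c x' u\<bar> \<le> \<alpha>c * l1_norm (x - x')"
    and T_lipschitz: "\<And>x x' u. x \<in> X \<Longrightarrow> x' \<in> X \<Longrightarrow> u \<in> U \<Longrightarrow> tv_dist (T x u) (T x' u) \<le> \<alpha>T * l1_norm (x - x')"
    and sets_\<mu>: "sets \<mu> = sets (restrict_space borel X)" and \<mu>_pos: "0 < emeasure \<mu> X"
    and minorization: "\<And>x u A. x \<in> X \<Longrightarrow> u \<in> U \<Longrightarrow> A \<in> sets (restrict_space borel X) \<Longrightarrow>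
      emeasure \<mu> A \<le> emeasure (T x u) A"
    and V_nonneg: "\<And>x. x \<in> X \<Longrightarrow> 0 \<le> V x"
    and V_integrable: "\<And>x u. x \<in> X \<Longrightarrow> u \<in> U \<Longrightarrow> integrable (T x u) V"
    and V_drift: "\<And>x u. x \<in> X \<Longrightarrow> u \<in> U \<Longrightarrow> (LINT x'|T x u. V x') \<le> V x - f x + b"
begin

abbreviation "MX \<equiv> restrict_space borel X"
abbreviation "MU \<equiv> restrict_space borel U"

lemma space_MX [simp]: "space MX = X" and space_MU [simp]: "space MU = U"
  by (simp_all add: space_restrict_space)

text \<open>Finite sets are closed in a Hausdorff space, so every set of actions is Borel.\<close>

lemma sets_MU: "sets MU = sets (count_space U)"
proof -
  have "A \<in> sets MU" if "A \<subseteq> U" for A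
  proof -
    have "A \<in> sets borel" by (intro borel_closed finite_imp_closed finite_subset[OF that U(1)])
    then show ?thesis unfolding sets_restrict_space by (rule rev_image_eqI) (use that in auto)
  qed
  then show ?thesis using sets.sets_into_space[of _ MU] by auto
qed

lemma X_nonempty: "X \<noteq> {}"
  using \<mu>_pos by auto

lemma prob_space_T: "x \<in> X \<Longrightarrow> u \<in> U \<Longrightarrow> prob_space (T x u)"
  and sets_T: "x \<in> X \<Longrightarrow> u \<in> U \<Longrightarrow> sets (T x u) = sets MX"
  using measurable_space[OF kernel[unfolded stochastic_kernel_def], of "(x, u)"]
  by (auto simp: space_pair_measure space_prob_algebra)

lemma space_T: "x \<in> X \<Longrightarrow> u \<in> U \<Longrightarrow> space (T x u) = X"
  using sets_eq_imp_space_eq[OF sets_T] by simp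

lemma space_\<mu>: "space \<mu> = X"
  using sets_eq_imp_space_eq[OF sets_\<mu>] by simp

lemma emeasure_\<mu>_le: "emeasure \<mu> X \<le> 1"
proof -
  obtain x u where xu: "x \<in> X" "u \<in> U" using X_nonempty U by blast
  have "emeasure \<mu> X \<le> emeasure (T x u) X"
    using minorization[OF xu, of X] sets.top[of MX] by simp
  also have "\<dots> = 1"
    using prob_space.emeasure_space_1[OF prob_space_T[OF xu]] by (simp add: space_T[OF xu])
  finally show ?thesis .
qed

sublocale \<mu>: finite_measure \<mu>
proof
  show "emeasure \<mu> (space \<mu>) \<noteq> \<infinity>"
    by (metis emeasure_\<mu>_le ennreal_one_less_top infinity_ennreal_def leD space_\<mu>)
qed

lemma measure_\<mu>_pos: "0 < measure \<mu> X"
  using \<mu>_pos by (simp add: \<mu>.emeasure_eq_measure)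

lemma measure_minorization:
  assumes "x \<in> X" "u \<in> U" "A \<in> sets MX"
  shows "measure \<mu> A \<le> measure (T x u) A"
proof -
  interpret T: prob_space "T x u" using assms by (intro prob_space_T)
  show ?thesis
    using minorization[OF assms] by (simp add: \<mu>.emeasure_eq_measure T.emeasure_eq_measure)
qed

lemma K_nonneg: "0 \<le> K"
proof -
  obtain x u where "x \<in> X" "u \<in> U" using X_nonempty U by blast
  then show ?thesis using c_nonneg c_le order_trans by blast
qed

text \<open>Integrability under one transition law includes measurability, and all these laws live
  on the sigma-algebra of \<open>MX\<close>.\<close>

lemma V_meas: "V \<in> borel_measurable MX"
proof -
  obtain x u where xu: "x \<in> X" "u \<in> U" using X_nonempty U by blast
  have "V \<in> borel_measurable (T x u)"
    using V_integrable[OF xu] by (rule borel_measurable_integrable)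
  then show ?thesis by (simp add: measurable_cong_sets[OF sets_T[OF xu] refl])
qed

text \<open>By minorization, \<open>V\<close> equals its infimum \<open>v\<close> almost everywhere with respect to \<open>\<mu>\<close>; where the
  infimum is attained the expected drift cannot be negative, so that \<open>f \<le> b\<close> there.\<close>

lemma exists_sublevel_point: "\<exists>x\<in>X. f x \<le> b"
proof -
  define v where "v = Inf (V ` X)"
  obtain u where u: "u \<in> U" using U by blast
  have bdd: "bdd_below (V ` X)" using V_nonneg by (intro bdd_belowI[of _ 0]) auto
  have v_le: "v \<le> V x" if "x \<in> X" for x
    unfolding v_def using that bdd by (intro cInf_lower) auto
  have [measurable]: "V \<in> borel_measurable \<mu>"
    using V_meas by (simp add: measurable_cong_sets[OF sets_\<mu> refl])
  \<comment> \<open>Since \<open>V - v\<close> is nonnegative, the minorization can be integrated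
    against it; the drift then bounds the result.\<close>
  have key: "(\<integral>\<^sup>+x'. ennreal (V x' - v) \<partial>\<mu>) \<le> ennreal (V x - f x + b - v)" if x: "x \<in> X" for x
  proof -
    interpret T: prob_space "T x u" by (rule prob_space_T[OF x u])
    have "\<mu> \<le> T x u"
      using minorization[OF x u] by (simp add: le_measure sets_\<mu> sets_T[OF x u])
    then have "(\<integral>\<^sup>+x'. ennreal (V x' - v) \<partial>\<mu>) \<le> (\<integral>\<^sup>+x'. ennreal (V x' - v) \<partial>T x u)"
      by (intro nn_integral_mono_measure) (simp_all add: sets_\<mu> sets_T[OF x u])
    also have "\<dots> = ennreal (LINT x'|T x u. V x' - v)"
      using V_integrable[OF x u] v_le
      by (intro nn_integral_eq_integral AE_I2) (auto simp: space_T[OF x u])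
    also have "(LINT x'|T x u. V x' - v) = (LINT x'|T x u. V x') - v"
      using V_integrable[OF x u] by (simp add: T.prob_space)
    also have "ennreal \<dots> \<le> ennreal (V x - f x + b - v)"
      using V_drift[OF x u] by (intro ennreal_leI) simp
    finally show ?thesis .
  qed
  show ?thesis
  proof (rule ccontr)
    assume "\<not> (\<exists>x\<in>X. f x \<le> b)"
    then have fb: "b < f x" if "x \<in> X" for x using that by force
    have small: "(\<integral>\<^sup>+x'. ennreal (V x' - v) \<partial>\<mu>) \<le> ennreal e" if "0 < e" for e
    proof -
      obtain x where x: "x \<in> X" "V x < v + e"
        using cInf_lessD[of "V ` X" "v + e"] X_nonempty \<open>0 < e\<close> by (auto simp: v_def)
      have "V x - f x + b - v \<le> e" using x fb[of x] by simp
      then show ?thesis using order_trans[OF key[OF x(1)] ennreal_leI] by blast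
    qed
    have "(\<integral>\<^sup>+x'. ennreal (V x' - v) \<partial>\<mu>) \<le> 0"
    proof (rule ennreal_le_epsilon)
      fix e :: real assume "0 < e"
      then show "(\<integral>\<^sup>+x'. ennreal (V x' - v) \<partial>\<mu>) \<le> 0 + ennreal e" using small by simp
    qed
    then have "(\<integral>\<^sup>+x'. ennreal (V x' - v) \<partial>\<mu>) = 0" by simp
    then have "AE x in \<mu>. ennreal (V x - v) = 0"
      by (subst (asm) nn_integral_0_iff_AE) auto
    \<comment> \<open>Under a measure of positive mass nothing impossible holds almost everywhere,
      so some point attains the infimum.\<close>
    moreover have False if "AE x in \<mu>. ennreal (V x - v) = 0" "\<And>x. x \<in> X \<Longrightarrow> v < V x"
    proof -
      have "AE x in \<mu>. False"
        using that(1)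
      proof (rule AE_mp, intro AE_I2 impI)
        fix x assume "x \<in> space \<mu>" "ennreal (V x - v) = 0"
        then show False using that(2)[of x] by (simp add: space_\<mu> ennreal_eq_0_iff)
      qed
      then show False using \<mu>_pos by (simp add: eventually_False ae_filter_eq_bot_iff space_\<mu>)
    qed
    ultimately have "\<exists>x\<in>X. V x \<le> v" by (meson not_le)
    then obtain x where x: "x \<in> X" "V x \<le> v" by blast
    interpret T: prob_space "T x u" by (rule prob_space_T[OF x(1) u])
    have "v = (LINT x'|T x u. v)" by (simp add: T.prob_space)
    also have "\<dots> \<le> (LINT x'|T x u. V x')"
      using v_le V_integrable[OF x(1) u] by (intro integral_mono) (auto simp: space_T[OF x(1) u])
    also have "\<dots> \<le> V x - f x + b" by (rule V_drift[OF x(1) u])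
    also have "\<dots> < v" using x fb[of x] by simp
    finally show False by simp
  qed
qed

end

section \<open>The finite model of a quantizer with point-mass weights\<close>

locale quantized_mdp = lyapunov_mdp X U T c V f \<mu> K \<alpha>c \<alpha>T b
  for X :: "(real ^ 'n) set" and U :: "'u::t2_space set" and T c V f \<mu> K \<alpha>c \<alpha>T b +
  fixes M :: nat and B :: "nat \<Rightarrow> (real ^ 'n) set" and y :: "nat \<Rightarrow> real ^ 'n" and \<pi> :: "(real ^ 'n) measure"
  assumes quantizer: "quantizer X M B y \<pi>"
    and cond_\<pi>: "\<And>i. i < M \<Longrightarrow> uniform_measure \<pi> (B i) = return (restrict_space borel X) (y i)"
begin

abbreviation "S \<equiv> y ` {..<M}"
abbreviation "q \<equiv> quantize M B y"

lemma B_sets: "i < M \<Longrightarrow> B i \<in> sets MX"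
  and y_in_B: "i < M \<Longrightarrow> y i \<in> B i"
  and B_cover: "(\<Union>i<M. B i) = X"
  using quantizer by (auto simp: quantizer_def)

lemma B_subset: "i < M \<Longrightarrow> B i \<subseteq> X"
  using B_cover by blast

lemma S_subset: "S \<subseteq> X"
  using y_in_B B_subset by blast

lemma bin_y: "i < M \<Longrightarrow> bin M B (y i) = B i"
  using bin_index_eqI[OF quantizer] y_in_B by simp

text \<open>Bins are disjoint, so distinct bins have distinct representatives and the value of
  \<open>q\<close> determines the bin.\<close>

lemma bin_eq: "s \<in> S \<Longrightarrow> bin M B s = {x \<in> X. q x = s}"
proof -
  assume "s \<in> S"
  then obtain i where i: "i < M" "s = y i" by auto
  have "x \<in> B i \<longleftrightarrow> q x = y i" if "x \<in> X" for x
  proof -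
    obtain j where j: "j < M" "x \<in> B j" using \<open>x \<in> X\<close> B_cover by blast
    then have q: "q x = y j" using bin_index_eqI[OF quantizer] by (simp add: quantize_def)
    show ?thesis
    proof
      assume "x \<in> B i"
      then show "q x = y i" using bin_index_eqI[OF quantizer] i by (simp add: quantize_def)
    next
      assume "q x = y i"
      then have "y i \<in> B j" using q y_in_B[OF j(1)] by simp
      then have "i = j" using bin_index_eqI[OF quantizer] i j y_in_B by metis
      then show "x \<in> B i" using j by simp
    qed
  qed
  then show ?thesis using bin_y[OF i(1)] B_subset[OF i(1)] i(2) by auto
qed

lemma bin_sets: "s \<in> S \<Longrightarrow> bin M B s \<in> sets MX"
  using bin_y B_sets by auto

lemma q_in_S: "x \<in> X \<Longrightarrow> q x \<in> S"
proof -
  assume "x \<in> X"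
  then obtain j where j: "j < M" "x \<in> B j" using B_cover by blast
  then show ?thesis using bin_index_eqI[OF quantizer] by (simp add: quantize_def)
qed

lemma q_meas: "q \<in> MX \<rightarrow>\<^sub>M count_space S"
proof (subst measurable_count_space_eq2)
  have "q -` {s} \<inter> space MX \<in> sets MX" if "s \<in> S" for s
  proof -
    have "q -` {s} \<inter> space MX = bin M B s" unfolding bin_eq[OF that] by auto
    then show ?thesis using bin_sets[OF that] by simp
  qed
  then show "q \<in> space MX \<rightarrow> S \<and> (\<forall>s\<in>S. q -` {s} \<inter> space MX \<in> sets MX)"
    using q_in_S by auto
qed simp

lemma quantized_meas: "(\<lambda>x. h (q x)) \<in> borel_measurable MX"
  by (rule measurable_compose[OF q_meas]) simp

text \<open>The integrand is constant on each bin. Sums over the finite model thus become integrals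
  over \<open>X\<close>, where the two models can be compared.\<close>

lemma integral_quantized:
  assumes N: "finite_measure N" and sets: "sets N = sets MX"
  shows "(LINT x|N. h (q x)) = (\<Sum>s\<in>S. measure N (bin M B s) * h s)"
proof -
  interpret finite_measure N by fact
  have sp: "space N = X" using sets_eq_imp_space_eq[OF sets] by simp
  have "(LINT x|N. h (q x)) = (LINT x|N. (\<Sum>s\<in>S. indicator (bin M B s) x * h s))"
  proof (rule Bochner_Integration.integral_cong[OF refl])
    fix x assume "x \<in> space N"
    then have x: "x \<in> X" by (simp add: sp)
    have "(\<Sum>s\<in>S. indicator (bin M B s) x * h s) = (\<Sum>s\<in>S. if s = q x then h s else 0)"
      using x by (intro sum.cong refl) (auto simp: bin_eq indicator_def)
    also have "\<dots> = h (q x)" using q_in_S[OF x] by simp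
    finally show "h (q x) = (\<Sum>s\<in>S. indicator (bin M B s) x * h s)" by simp
  qed
  also have "\<dots> = (\<Sum>s\<in>S. (LINT x|N. indicator (bin M B s) x * h s))"
    using bin_sets sets
    by (intro Bochner_Integration.integral_sum integrable_mult_left integrable_real_indicator)
       (auto simp: emeasure_eq_measure)
  also have "\<dots> = (\<Sum>s\<in>S. measure N (bin M B s) * h s)"
  proof (rule sum.cong[OF refl])
    fix s assume "s \<in> S"
    then have "bin M B s \<inter> space N = bin M B s"
      using bin_sets sets.sets_into_space[of "bin M B s" N] by (auto simp: sets)
    then show "(LINT x|N. indicator (bin M B s) x * h s) = measure N (bin M B s) * h s"
      by simp
  qed
  finally show ?thesis .
qed

lemma sum_measure_bins:
  assumes "finite_measure N" and sets: "sets N = sets MX"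
  shows "(\<Sum>s\<in>S. measure N (bin M B s)) = measure N X"
  using integral_quantized[OF assms, of "\<lambda>_. 1"] sets_eq_imp_space_eq[OF sets] by simp

lemma integral_T_quantized:
  "x \<in> X \<Longrightarrow> u \<in> U \<Longrightarrow> (LINT x'|T x u. h (q x')) = (\<Sum>s\<in>S. measure (T x u) (bin M B s) * h s)"
  by (intro integral_quantized sets_T prob_space.finite_measure prob_space_T)

text \<open>All conditional mass of a bin sits at its representative, so averaging over the bin is
  evaluation at \<open>s\<close>.\<close>

lemma finite_cost_eq: "s \<in> S \<Longrightarrow> u \<in> U \<Longrightarrow> finite_cost M B \<pi> c s u = c s u"
proof -
  assume s: "s \<in> S" and u: "u \<in> U"
  then obtain i where i: "i < M" "s = y i" by auto
  have "(\<lambda>x. indicat_real (B i) x *\<^sub>R c x u) \<in> borel_measurable MX"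
    by (intro borel_measurable_scaleR borel_measurable_indicator B_sets[OF i(1)] c_meas[OF u])
  then show ?thesis
    using i y_in_B[OF i(1)] B_subset[OF i(1)]
    by (auto simp: finite_cost_def bin_y cond_\<pi> set_lebesgue_integral_def integral_return)
qed

lemma finite_prob_eq:
  "s \<in> S \<Longrightarrow> u \<in> U \<Longrightarrow> s' \<in> S \<Longrightarrow> finite_prob M B \<pi> T s u s' = measure (T s u) (bin M B s')"
proof -
  assume s: "s \<in> S" and u: "u \<in> U" and s': "s' \<in> S"
  then obtain i where i: "i < M" "s = y i" by auto
  have "(\<lambda>x. (x, u)) \<in> MX \<rightarrow>\<^sub>M MX \<Otimes>\<^sub>M MU" using u by (intro measurable_Pair2') simp
  from measurable_compose[OF this measurable_prob_algebraD[OF kernel[unfolded stochastic_kernel_def]]]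
  have "(\<lambda>x. T x u) \<in> MX \<rightarrow>\<^sub>M subprob_algebra MX" by simp
  from measurable_compose[OF this measurable_measure_subprob_algebra[OF bin_sets[OF s']]]
  have "(\<lambda>x. indicat_real (B i) x *\<^sub>R measure (T x u) (bin M B s')) \<in> borel_measurable MX"
    by (intro borel_measurable_scaleR borel_measurable_indicator B_sets[OF i(1)])
  then show ?thesis
    using i y_in_B[OF i(1)] B_subset[OF i(1)]
    by (auto simp: finite_prob_def bin_y cond_\<pi> set_lebesgue_integral_def integral_return)
qed

text \<open>The minorization passes to the finite model: the masses of the bins under
  \<open>\<mu>\<close> serve as \<open>\<nu>\<close> and have total mass
  \<open>measure \<mu> X\<close>, so the bound on \<open>H\<close> does not depend on the number of
  bins.\<close>

lemma optimality_equation: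
  obtains g H where "0 \<le> g" "g \<le> K"
    "\<And>s. s \<in> S \<Longrightarrow> 0 \<le> H s" "\<And>s. s \<in> S \<Longrightarrow> H s \<le> K / measure \<mu> X"
    "\<And>s u. s \<in> S \<Longrightarrow> u \<in> U \<Longrightarrow> g + H s \<le> c s u + (LINT x|T s u. H (q x))"
    "\<And>s. s \<in> S \<Longrightarrow> \<exists>u\<in>U. g + H s = c s u + (LINT x|T s u. H (q x))"
proof -
  note SX = subsetD[OF S_subset]
  obtain g H where gH: "0 \<le> g" "g \<le> K"
    "\<And>s. s \<in> S \<Longrightarrow> 0 \<le> H s" "\<And>s. s \<in> S \<Longrightarrow> H s \<le> K / measure \<mu> X"
    "\<And>s u. s \<in> S \<Longrightarrow> u \<in> U \<Longrightarrow> g + H s \<le> c s u + (\<Sum>s'\<in>S. measure (T s u) (bin M B s') * H s')"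
    "\<And>s. s \<in> S \<Longrightarrow> \<exists>u\<in>U. g + H s = c s u + (\<Sum>s'\<in>S. measure (T s u) (bin M B s') * H s')"
  proof (rule average_cost_optimality_equation[of U S "\<lambda>s'. measure \<mu> (bin M B s')"
        "\<lambda>s u s'. measure (T s u) (bin M B s')" "measure \<mu> X" c K])
    show "finite U" "U \<noteq> {}" by (fact U)+
    show "measure \<mu> (bin M B s') \<le> measure (T s u) (bin M B s')" if "s \<in> S" "u \<in> U" "s' \<in> S" for s u s'
      using that by (intro measure_minorization SX bin_sets)
    show "0 \<le> measure \<mu> (bin M B s)" for s by simp
    show "(\<Sum>s'\<in>S. measure (T s u) (bin M B s')) = 1" if su: "s \<in> S" "u \<in> U" for s u
    proof -
      note s = SX[OF su(1)]
      have "(\<Sum>s'\<in>S. measure (T s u) (bin M B s')) = measure (T s u) X"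
        by (rule sum_measure_bins[OF prob_space.finite_measure[OF prob_space_T[OF s su(2)]] sets_T[OF s su(2)]])
      then show ?thesis
        using prob_space.prob_space[OF prob_space_T[OF s su(2)]] by (simp add: space_T[OF s su(2)])
    qed
    show "(\<Sum>s\<in>S. measure \<mu> (bin M B s)) = measure \<mu> X"
      by (rule sum_measure_bins[OF \<mu>.finite_measure_axioms sets_\<mu>])
    show "0 < measure \<mu> X" by (rule measure_\<mu>_pos)
    show "0 \<le> c s u" "c s u \<le> K" if "s \<in> S" "u \<in> U" for s u
      using that by (auto intro: c_nonneg c_le SX)
    show "0 \<le> K" by (rule K_nonneg)
  qed (rule that)
  show thesis
  proof (rule that[of g H])
    show "g + H s \<le> c s u + (LINT x|T s u. H (q x))" if "s \<in> S" "u \<in> U" for s u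
      using gH(5)[OF that] by (simp add: integral_T_quantized[OF SX[OF that(1)] that(2)])
    show "\<exists>u\<in>U. g + H s = c s u + (LINT x|T s u. H (q x))" if s: "s \<in> S" for s
    proof -
      obtain u where "u \<in> U" "g + H s = c s u + (\<Sum>s'\<in>S. measure (T s u) (bin M B s') * H s')"
        using gH(6)[OF s] by blast
      then show ?thesis
        by (intro bexI[of _ u]) (simp_all add: integral_T_quantized[OF SX[OF s]])
    qed
  qed (fact gH(1-4))+
qed

end

lemma stationary_policy_admissible:
  assumes "\<phi> \<in> MX \<rightarrow>\<^sub>M MU"
  shows "(\<lambda>t xs us. \<phi> (xs t)) \<in> admissible_policies MX MU"
proof -
  have "(\<lambda>z. \<phi> (fst z t)) \<in> PiM {..t} (\<lambda>_. MX) \<Otimes>\<^sub>M PiM {..<t} (\<lambda>_. MU) \<rightarrow>\<^sub>M MU" for t :: nat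
  proof (rule measurable_compose[OF _ assms])
    show "(\<lambda>z. fst z t) \<in> PiM {..t} (\<lambda>_. MX) \<Otimes>\<^sub>M PiM {..<t} (\<lambda>_. MU) \<rightarrow>\<^sub>M MX"
      by (rule measurable_compose[OF measurable_fst], rule measurable_component_singleton) simp
  qed
  then show ?thesis by (simp add: admissible_policies_def split_beta)
qed

context quantized_mdp
begin

lemma cost_meas: "(\<lambda>(x, u). c x u) \<in> borel_measurable (MX \<Otimes>\<^sub>M MU)"
proof -
  have "(\<lambda>(u, x). c x u) \<in> borel_measurable (count_space U \<Otimes>\<^sub>M MX)"
    using countable_finite[OF U(1)] c_meas by (intro measurable_pair_measure_countable1) auto
  then have "(\<lambda>(x, u). c x u) \<in> borel_measurable (MX \<Otimes>\<^sub>M count_space U)"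
    by (subst measurable_pair_swap_iff) simp
  then show ?thesis
    by (simp add: measurable_cong_sets[OF sets_pair_measure_cong[OF refl sets_MU] refl])
qed

lemma prob_space_finite_kernel:
  assumes "s \<in> S" "u \<in> U"
  shows "prob_space (finite_kernel M B y \<pi> T s u)"
proof
  have sX: "s \<in> X" using assms(1) S_subset by blast
  have "emeasure (finite_kernel M B y \<pi> T s u) S = (\<Sum>z\<in>S. ennreal (measure (T s u) (bin M B z)))"
    by (simp add: finite_kernel_def emeasure_point_measure_finite finite_prob_eq[OF assms])
  also have "\<dots> = ennreal (\<Sum>z\<in>S. measure (T s u) (bin M B z))"
    by (rule sum_ennreal) simp
  also have "(\<Sum>z\<in>S. measure (T s u) (bin M B z)) = measure (T s u) X"
    by (intro sum_measure_bins prob_space.finite_measure prob_space_T sets_T sX assms(2))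
  also have "\<dots> = 1"
    using prob_space.prob_space[OF prob_space_T[OF sX assms(2)]] by (simp add: space_T[OF sX assms(2)])
  finally show "emeasure (finite_kernel M B y \<pi> T s u) (space (finite_kernel M B y \<pi> T s u)) = 1"
    by (simp add: finite_kernel_def space_point_measure)
qed

lemma sets_finite_kernel: "sets (finite_kernel M B y \<pi> T s u) = sets (count_space S)"
  by (simp add: finite_kernel_def sets_point_measure)

lemma integral_finite_kernel:
  fixes h :: "real ^ 'n \<Rightarrow> real"
  assumes "s \<in> S" "u \<in> U"
  shows "(LINT x|finite_kernel M B y \<pi> T s u. h x) = (LINT x|T s u. h (q x))"
proof -
  have "finite_kernel M B y \<pi> T s u = point_measure S (\<lambda>z. ennreal (measure (T s u) (bin M B z)))"
    unfolding finite_kernel_def point_measure_def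
    by (rule density_cong) (auto simp: finite_prob_eq[OF assms] AE_count_space)
  then have "(LINT x|finite_kernel M B y \<pi> T s u. h x) = (\<Sum>z\<in>S. measure (T s u) (bin M B z) * h z)"
    by (simp add: lebesgue_integral_point_measure_finite)
  also have "\<dots> = (LINT x|T s u. h (q x))"
    using assms S_subset by (intro integral_T_quantized[symmetric]) auto
  finally show ?thesis .
qed

lemma integrable_finite_kernel:
  fixes h :: "real ^ 'n \<Rightarrow> real"
  assumes "s \<in> S" "u \<in> U"
  shows "integrable (finite_kernel M B y \<pi> T s u) h"
proof -
  interpret prob_space "finite_kernel M B y \<pi> T s u" by (rule prob_space_finite_kernel[OF assms])
  have "finite (space (finite_kernel M B y \<pi> T s u))"
    by (simp add: finite_kernel_def space_point_measure)
  moreover have "h \<in> borel_measurable (finite_kernel M B y \<pi> T s u)"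
    by (simp add: measurable_cong_sets[OF sets_finite_kernel refl])
  ultimately show ?thesis
    by (intro integrable_const_bound[of _ "Max ((\<lambda>x. norm (h x)) ` space (finite_kernel M B y \<pi> T s u))"])
       (auto intro!: AE_I2 Max_ge)
qed

lemma integrable_quantized:
  fixes h :: "real ^ 'n \<Rightarrow> real"
  assumes "x \<in> X" "u \<in> U"
  shows "integrable (T x u) (\<lambda>x'. h (q x'))"
proof -
  interpret prob_space "T x u" by (rule prob_space_T[OF assms])
  have "\<bar>h (q x')\<bar> \<le> Max ((\<lambda>s. \<bar>h s\<bar>) ` S)" if "x' \<in> X" for x'
    using q_in_S[OF that] by (intro Max_ge) auto
  moreover have "(\<lambda>x'. h (q x')) \<in> borel_measurable (T x u)"
    using quantized_meas by (simp add: measurable_cong_sets[OF sets_T[OF assms] refl])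
  ultimately show ?thesis
    by (intro integrable_const_bound[of _ "Max ((\<lambda>s. \<bar>h s\<bar>) ` S)"]) (auto intro!: AE_I2 simp: space_T[OF assms])
qed

lemma sets_finite_pair: "sets (count_space S \<Otimes>\<^sub>M MU) = sets (count_space (S \<times> U))"
  unfolding sets_pair_measure_cong[OF refl sets_MU]
  by (rule arg_cong[OF pair_measure_countable]) (simp_all add: countable_finite U(1))

lemma finite_stochastic_kernel: "stochastic_kernel (count_space S) MU (finite_kernel M B y \<pi> T)"
  unfolding stochastic_kernel_def measurable_cong_sets[OF sets_finite_pair refl] measurable_count_space_eq1
  by (auto simp: space_prob_algebra sets_finite_kernel prob_space_finite_kernel)

lemma finite_cost_meas:
  "(\<lambda>(s, u). finite_cost M B \<pi> c s u) \<in> borel_measurable (count_space S \<Otimes>\<^sub>M MU)"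
  unfolding measurable_cong_sets[OF sets_finite_pair refl] by simp

text \<open>Verification: the optimality inequality with the potential \<open>R - H\<close> bounds
  every policy from below, and the stationary policy of minimizing actions \<open>\<phi>\<close>
  attains \<open>g\<close> by the potential \<open>H\<close>. The shift by \<open>R\<close> keeps
  the reversed potential nonnegative.\<close>

lemma finite_optimal_cost:
  assumes gK: "0 \<le> g" "g \<le> K"
    and H: "\<And>s. s \<in> S \<Longrightarrow> 0 \<le> H s" "\<And>s. s \<in> S \<Longrightarrow> H s \<le> R"
    and opt_le: "\<And>s u. s \<in> S \<Longrightarrow> u \<in> U \<Longrightarrow> g + H s \<le> c s u + (LINT x|T s u. H (q x))"
    and \<phi>: "\<And>s. s \<in> S \<Longrightarrow> \<phi> s \<in> U" "\<And>s. s \<in> S \<Longrightarrow> g + H s = c s (\<phi> s) + (LINT x|T s (\<phi> s). H (q x))"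
    and x0: "x0 \<in> X"
  shows "finite_opt_avg_cost M B y \<pi> MU T c x0 = ereal g"
proof -
  note s0 = q_in_S[OF x0]
  have cS: "0 \<le> finite_cost M B \<pi> c s u" "finite_cost M B \<pi> c s u \<le> K" if "s \<in> S" "u \<in> U" for s u
    using that S_subset by (auto simp: finite_cost_eq intro: c_nonneg c_le)
  have "ereal g \<le> avg_cost (count_space S) MU (finite_kernel M B y \<pi> T) (finite_cost M B \<pi> c) (q x0) \<gamma>"
    if \<gamma>: "\<gamma> \<in> admissible_policies (count_space S) MU" for \<gamma>
  proof -
    interpret P: controlled_process "count_space S" MU "finite_kernel M B y \<pi> T" \<gamma> "q x0"
      using finite_stochastic_kernel \<gamma> s0 by unfold_locales simp_all
    show ?thesis
    proof (rule P.avg_cost_ge[where \<Phi>="\<lambda>s. R - H s" and K=K])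
      fix s u assume "s \<in> space (count_space S)" "u \<in> space MU"
      then have su: "s \<in> S" "u \<in> U" by simp_all
      interpret Tsu: prob_space "T s u" using su S_subset by (intro prob_space_T) auto
      have "(LINT x|finite_kernel M B y \<pi> T s u. R - H x) = R - (LINT x|T s u. H (q x))"
        using integrable_quantized[of s u H] su S_subset
        by (simp add: integral_finite_kernel[OF su, of "\<lambda>s. R - H s"] subset_iff Tsu.prob_space)
      then show "g + (LINT x|finite_kernel M B y \<pi> T s u. R - H x) \<le> finite_cost M B \<pi> c s u + (R - H s)"
        using opt_le[OF su] by (simp add: finite_cost_eq[OF su])
      show "integrable (finite_kernel M B y \<pi> T s u) (\<lambda>s. R - H s)"
        by (rule integrable_finite_kernel[OF su])
      show "0 \<le> finite_cost M B \<pi> c s u" "finite_cost M B \<pi> c s u \<le> K"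
        by (fact cS[OF su])+
    qed (use H gK finite_cost_meas in auto)
  qed
  moreover have "opt_avg_cost (count_space S) MU (finite_kernel M B y \<pi> T) (finite_cost M B \<pi> c) (q x0) \<le> ereal g"
    unfolding opt_avg_cost_def
  proof (rule INF_lower2)
    show \<gamma>: "(\<lambda>t xs us. \<phi> (xs t)) \<in> admissible_policies (count_space S) MU"
      using \<phi>(1) by (intro stationary_policy_admissible) simp
    interpret P: controlled_process "count_space S" MU "finite_kernel M B y \<pi> T" "\<lambda>t xs us. \<phi> (xs t)" "q x0"
      using finite_stochastic_kernel \<gamma> s0 by unfold_locales simp_all
    show "avg_cost (count_space S) MU (finite_kernel M B y \<pi> T) (finite_cost M B \<pi> c) (q x0)
        (\<lambda>t xs us. \<phi> (xs t)) \<le> ereal g"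
    proof (rule P.avg_cost_le[where \<Phi>=H])
      show "integrable (finite_kernel M B y \<pi> T s u) H" "0 \<le> finite_cost M B \<pi> c s u"
        if "s \<in> space (count_space S)" "u \<in> space MU" for s u
        using that by (auto intro: integrable_finite_kernel cS)
      fix t and xs :: "nat \<Rightarrow> real ^ 'n"
      assume "xs t \<in> space (count_space S)"
      then have s: "xs t \<in> S" by simp
      show "finite_cost M B \<pi> c (xs t) (\<phi> (xs t)) + (LINT x'|finite_kernel M B y \<pi> T (xs t) (\<phi> (xs t)). H x')
          \<le> g + H (xs t)"
        using \<phi>(2)[OF s] by (simp add: finite_cost_eq[OF s \<phi>(1)[OF s]] integral_finite_kernel[OF s \<phi>(1)[OF s]])
    qed (use H gK finite_cost_meas in auto)
  qed
  ultimately show ?thesis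
    unfolding finite_opt_avg_cost_def opt_avg_cost_def by (intro antisym INF_greatest) auto
qed

text \<open>The value function of the finite model, extended to \<open>X\<close> by \<open>q\<close> and corrected by a multiple
  of \<open>V\<close> that absorbs the quantization error, is a super- or subsolution of the average cost
  optimality equation of the original model.\<close>

lemma quantized_cost_error:
  assumes x0: "x0 \<in> X" and k: "0 \<le> k" and near: "\<And>x. x \<in> X \<Longrightarrow> l1_norm (x - q x) \<le> a + k * f x"
  shows "\<bar>finite_opt_avg_cost M B y \<pi> MU T c x0 - opt_avg_cost MX MU T c x0\<bar>
    \<le> ereal ((\<alpha>c + \<alpha>T * K / measure \<mu> X) * (a + k * b))"
proof -
  define R where "R = K / measure \<mu> X"
  define L where "L = \<alpha>c + \<alpha>T * R"
  define E where "E = L * (a + k * b)"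
  have R0: "0 \<le> R" using K_nonneg measure_\<mu>_pos by (simp add: R_def)
  have L0: "0 \<le> L" using \<alpha> R0 by (simp add: L_def)
  obtain g H where gK: "0 \<le> g" "g \<le> K"
    and H: "\<And>s. s \<in> S \<Longrightarrow> 0 \<le> H s" "\<And>s. s \<in> S \<Longrightarrow> H s \<le> R"
    and opt_le: "\<And>s u. s \<in> S \<Longrightarrow> u \<in> U \<Longrightarrow> g + H s \<le> c s u + (LINT x|T s u. H (q x))"
    and opt_ex: "\<And>s. s \<in> S \<Longrightarrow> \<exists>u\<in>U. g + H s = c s u + (LINT x|T s u. H (q x))"
    by (rule optimality_equation[folded R_def], rule that)
  obtain \<phi> where \<phi>: "\<And>s. s \<in> S \<Longrightarrow> \<phi> s \<in> U"
    "\<And>s. s \<in> S \<Longrightarrow> g + H s = c s (\<phi> s) + (LINT x|T s (\<phi> s). H (q x))"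
    using bchoice[of S "\<lambda>s u. u \<in> U \<and> g + H s = c s u + (LINT x|T s u. H (q x))"] opt_ex by blast
  have fin: "finite_opt_avg_cost M B y \<pi> MU T c x0 = ereal g"
    by (rule finite_optimal_cost[OF gK H opt_le \<phi> x0])
  \<comment> \<open>\<open>a\<close> may be negative; at a point with \<open>f x \<le> b\<close> the
    bound on the distance gives \<open>0 \<le> a + k * f x \<le> a + k * b\<close>.\<close>
  have E0: "0 \<le> E"
  proof -
    obtain x where "x \<in> X" "f x \<le> b" using exists_sublevel_point by blast
    then have "0 \<le> a + k * b"
      using near[of x] l1_norm_nonneg[of "x - q x"] mult_left_mono[of "f x" b k] k by linarith
    then show ?thesis using L0 by (simp add: E_def)
  qed
  have Vx: "k * f x + k * (LINT x'|T x u. V x') \<le> k * V x + k * b" if "x \<in> X" "u \<in> U" for x u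
    using mult_left_mono[OF V_drift[OF that] k] by (simp add: algebra_simps)
  \<comment> \<open>The values of \<open>H\<close> lie between 0 and \<open>R\<close>, so cost and
    transition errors add up to at most \<open>L * l1_norm (x - q x)\<close>, hence to
    \<open>L * (a + k * f x)\<close>. The drift of \<open>L * k * V\<close> absorbs the term with
    \<open>f x\<close> and leaves the constant \<open>E\<close>.\<close>
  have err: "\<bar>c x u + (LINT x'|T x u. H (q x')) - (c (q x) u + (LINT x'|T (q x) u. H (q x')))\<bar>
      + L * k * (LINT x'|T x u. V x') \<le> E + L * k * V x" if xu: "x \<in> X" "u \<in> U" for x u
  proof -
    have qX: "q x \<in> X" using q_in_S[OF xu(1)] S_subset by blast
    have "\<bar>(LINT x'|T x u. H (q x')) - (LINT x'|T (q x) u. H (q x'))\<bar> \<le> R * tv_dist (T x u) (T (q x) u)"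
    proof (rule integral_diff_le_tv_dist)
      show "(\<lambda>x'. H (q x')) \<in> borel_measurable (T x u)"
        using quantized_meas by (simp add: measurable_cong_sets[OF sets_T[OF xu] refl])
      show "\<bar>H (q x')\<bar> \<le> R" if "x' \<in> space (T x u)" for x'
        using that H q_in_S[of x'] by (auto simp: space_T[OF xu])
    qed (use xu qX R0 prob_space_T sets_T in auto)
    also have "\<dots> \<le> R * (\<alpha>T * l1_norm (x - q x))"
      by (intro mult_left_mono T_lipschitz xu qX R0)
    finally have "\<bar>c x u + (LINT x'|T x u. H (q x')) - (c (q x) u + (LINT x'|T (q x) u. H (q x')))\<bar>
        \<le> L * l1_norm (x - q x)"
      using c_lipschitz[OF xu(1) qX xu(2)] by (simp add: L_def algebra_simps)
    also have "\<dots> \<le> L * (a + k * f x)"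
      using near[OF xu(1)] L0 by (rule mult_left_mono)
    moreover have "L * (k * f x + k * (LINT x'|T x u. V x')) \<le> L * (k * V x + k * b)"
      using Vx[OF xu] L0 by (rule mult_left_mono)
    ultimately show ?thesis by (simp add: E_def algebra_simps)
  qed
  have V_k: "(\<lambda>x. L * k * V x) \<in> borel_measurable MX" using V_meas by simp
  have "ereal (g - E) \<le> avg_cost MX MU T c x0 \<gamma>" if \<gamma>: "\<gamma> \<in> admissible_policies MX MU" for \<gamma>
  proof -
    interpret P: controlled_process MX MU T \<gamma> x0
      using kernel \<gamma> x0 by unfold_locales simp_all
    show ?thesis
    \<comment> \<open>\<open>H\<close> enters with reversed sign as in the finite model, but
      \<open>V\<close> has a positive sign in both directions, because it compensates the error and
      not the value.\<close>
    proof (rule P.avg_cost_ge[where \<Phi>="\<lambda>x. (R - H (q x)) + L * k * V x" and K=K])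
      show "(\<lambda>x. (R - H (q x)) + L * k * V x) \<in> borel_measurable MX"
        using quantized_meas[of "\<lambda>s. R - H s"] V_k by simp
      show "0 \<le> (R - H (q x)) + L * k * V x" if "x \<in> space MX" for x
        using that H(2)[OF q_in_S[of x]] V_nonneg[of x] L0 k by simp
      fix x u assume "x \<in> space MX" "u \<in> space MU"
      then have xu: "x \<in> X" "u \<in> U" by simp_all
      note int = integrable_quantized[OF xu, of H] V_integrable[OF xu]
      show "integrable (T x u) (\<lambda>x. (R - H (q x)) + L * k * V x)"
        using integrable_quantized[OF xu, of "\<lambda>s. R - H s"] int by simp
      show "0 \<le> c x u" "c x u \<le> K" using xu by (auto intro: c_nonneg c_le)
      interpret Txu: prob_space "T x u" by (rule prob_space_T[OF xu])
      have "(LINT x'|T x u. (R - H (q x')) + L * k * V x') =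
          R - (LINT x'|T x u. H (q x')) + L * k * (LINT x'|T x u. V x')"
        using int by (simp add: Txu.prob_space)
      then show "g - E + (LINT x'|T x u. (R - H (q x')) + L * k * V x') \<le> c x u + ((R - H (q x)) + L * k * V x)"
        using err[OF xu] opt_le[OF q_in_S[OF xu(1)] xu(2)] by linarith
    qed (use cost_meas E0 gK in auto)
  qed
  then have lower: "ereal (g - E) \<le> opt_avg_cost MX MU T c x0"
    unfolding opt_avg_cost_def by (rule INF_greatest)
  have upper: "opt_avg_cost MX MU T c x0 \<le> ereal (g + E)"
    unfolding opt_avg_cost_def
  proof (rule INF_lower2)
    \<comment> \<open>The comparison policy acts at \<open>x\<close> as the optimal policy of the
      finite model acts at \<open>q x\<close>.\<close>
    have "(\<lambda>x. \<phi> (q x)) \<in> MX \<rightarrow>\<^sub>M MU"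
      by (rule measurable_compose[OF q_meas]) (use \<phi>(1) in simp)
    then show \<gamma>: "(\<lambda>t xs us. \<phi> (q (xs t))) \<in> admissible_policies MX MU"
      by (rule stationary_policy_admissible)
    interpret P: controlled_process MX MU T "\<lambda>t xs us. \<phi> (q (xs t))" x0
      using kernel \<gamma> x0 by unfold_locales simp_all
    show "avg_cost MX MU T c x0 (\<lambda>t xs us. \<phi> (q (xs t))) \<le> ereal (g + E)"
    proof (rule P.avg_cost_le[where \<Phi>="\<lambda>x. H (q x) + L * k * V x"])
      show "(\<lambda>x. H (q x) + L * k * V x) \<in> borel_measurable MX"
        using quantized_meas[of H] V_k by simp
      show "0 \<le> H (q x) + L * k * V x" if "x \<in> space MX" for x
        using that H(1)[OF q_in_S[of x]] V_nonneg[of x] L0 k by simp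
      show "integrable (T x u) (\<lambda>x. H (q x) + L * k * V x)" "0 \<le> c x u"
        if "x \<in> space MX" "u \<in> space MU" for x u
        using that integrable_quantized[of x u H] V_integrable[of x u] by (auto intro: c_nonneg)
      fix t and xs :: "nat \<Rightarrow> real ^ 'n"
      assume "xs t \<in> space MX"
      then have x: "xs t \<in> X" by simp
      note s = q_in_S[OF x]
      note u = \<phi>(1)[OF s]
      have "(LINT x'|T (xs t) (\<phi> (q (xs t))). H (q x') + L * k * V x') =
          (LINT x'|T (xs t) (\<phi> (q (xs t))). H (q x')) + L * k * (LINT x'|T (xs t) (\<phi> (q (xs t))). V x')"
        using integrable_quantized[OF x u, of H] V_integrable[OF x u] by simp
      then show "c (xs t) (\<phi> (q (xs t))) + (LINT x'|T (xs t) (\<phi> (q (xs t))). H (q x') + L * k * V x')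
          \<le> g + E + (H (q (xs t)) + L * k * V (xs t))"
        using err[OF x u] \<phi>(2)[OF s] by linarith
    qed (use cost_meas E0 gK in auto)
  qed
  \<comment> \<open>Both bounds are finite, so the optimal cost is a real number and the difference
    can be taken in the reals.\<close>
  obtain J where J: "opt_avg_cost MX MU T c x0 = ereal J"
    using lower upper by (cases "opt_avg_cost MX MU T c x0") auto
  have "\<bar>g - J\<bar> \<le> E" using lower upper by (simp add: J)
  then show ?thesis by (simp add: fin J E_def L_def R_def)
qed

end

section \<open>Assembling the error bound\<close>

theorem theorem2p8:
  fixes X :: "(real ^ 'n) set"
    and U :: "'u::t2_space set"
    and T :: "real ^ 'n \<Rightarrow> 'u \<Rightarrow> (real ^ 'n) measure"
    and c :: "real ^ 'n \<Rightarrow> 'u \<Rightarrow> real"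
    and V :: "real ^ 'n \<Rightarrow> real"
    and \<mu> :: "(real ^ 'n) measure"
    and \<alpha>c \<alpha>T b m :: real
    and M :: nat
  defines "MX \<equiv> restrict_space borel X"
    and "MU \<equiv> restrict_space borel U"
  assumes "X \<in> sets borel"
    and "compact U" "finite U" "U \<noteq> {}"
    and "stochastic_kernel MX MU T"
    and "\<forall>x\<in>X. \<forall>u\<in>U. 0 \<le> c x u"
    and "bounded ((\<lambda>(x, u). c x u) ` (X \<times> U))"
    and "continuous_on (X \<times> U) (\<lambda>(x, u). c x u)"
    and "weak_feller X U T"
    and "\<alpha>c > 0" "\<alpha>T > 0"
    and "\<forall>x\<in>X. \<forall>x'\<in>X. \<forall>u\<in>U. \<bar>c x u - c x' u\<bar> \<le> \<alpha>c * l1_norm (x - x')"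
    and "\<forall>x\<in>X. \<forall>x'\<in>X. \<forall>u\<in>U. tv_dist (T x u) (T x' u) \<le> \<alpha>T * l1_norm (x - x')"
    and "sets \<mu> = sets MX" "emeasure \<mu> X > 0"
    and "\<forall>x\<in>X. \<forall>u\<in>U. \<forall>A\<in>sets MX. emeasure (T x u) A \<ge> emeasure \<mu> A"
    and "m > 1" "b \<ge> 0"
    and "\<forall>x\<in>X. 0 \<le> V x"
    and "\<forall>x\<in>X. \<forall>u\<in>U. integrable (T x u) V \<and>
           (LINT x'|T x u. V x') \<le> V x - l1_norm x powr m + b"
    and "M \<ge> 1" "finite X \<longrightarrow> M \<le> card X"
  shows "\<exists>B y \<pi>. quantizer X M B y \<pi> \<and>
    (\<forall>x\<^sub>0\<in>X.
      \<bar>finite_opt_avg_cost M B y \<pi> MU T c x\<^sub>0 - opt_avg_cost MX MU T c x\<^sub>0\<bar>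
        \<le> ereal ((\<alpha>c + \<alpha>T * (SUP (x, u)\<in>X \<times> U. \<bar>c x u\<bar>) / measure \<mu> X) *
            ((2 * real CARD('n) + 1) * b powr (1 / m)
              / real M powr (1 / real CARD('n) * (1 - 1 / m)))))"
proof -
  define K where "K = (SUP (x, u)\<in>X \<times> U. \<bar>c x u\<bar>)"
  obtain r where r: "\<And>x u. x \<in> X \<Longrightarrow> u \<in> U \<Longrightarrow> \<bar>c x u\<bar> \<le> r"
    using \<open>bounded ((\<lambda>(x, u). c x u) ` (X \<times> U))\<close> by (force simp: bounded_iff)
  have "bdd_above ((\<lambda>(x, u). \<bar>c x u\<bar>) ` (X \<times> U))"
    using r by (intro bdd_aboveI[of _ r]) auto
  then have cK: "c x u \<le> K" if "x \<in> X" "u \<in> U" for x u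
    using cSUP_upper[of "(x, u)" "X \<times> U" "\<lambda>(x, u). \<bar>c x u\<bar>"] that by (auto simp: K_def)
  have c_meas: "(\<lambda>x. c x u) \<in> borel_measurable (restrict_space borel X)" if "u \<in> U" for u
  proof (rule borel_measurable_continuous_on_restrict)
    have "continuous_on X (\<lambda>x. (\<lambda>(x, u). c x u) (x, u))"
      by (rule continuous_on_compose2[OF \<open>continuous_on (X \<times> U) (\<lambda>(x, u). c x u)\<close>])
         (use that in \<open>auto intro!: continuous_intros\<close>)
    then show "continuous_on X (\<lambda>x. c x u)" by simp
  qed
  interpret lyapunov_mdp X U T c V "\<lambda>x. l1_norm x powr m" \<mu> K \<alpha>c \<alpha>T b
  proof (rule lyapunov_mdp.intro)
    show "stochastic_kernel (restrict_space borel X) (restrict_space borel U) T"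
      using \<open>stochastic_kernel MX MU T\<close> by (simp only: MX_def MU_def)
    show "0 \<le> c x u" if "x \<in> X" "u \<in> U" for x u
      using \<open>\<forall>x\<in>X. \<forall>u\<in>U. 0 \<le> c x u\<close> that by blast
    show "\<bar>c x u - c x' u\<bar> \<le> \<alpha>c * l1_norm (x - x')" if "x \<in> X" "x' \<in> X" "u \<in> U" for x x' u
      using \<open>\<forall>x\<in>X. \<forall>x'\<in>X. \<forall>u\<in>U. \<bar>c x u - c x' u\<bar> \<le> \<alpha>c * l1_norm (x - x')\<close> that by blast
    show "tv_dist (T x u) (T x' u) \<le> \<alpha>T * l1_norm (x - x')" if "x \<in> X" "x' \<in> X" "u \<in> U" for x x' u
      using \<open>\<forall>x\<in>X. \<forall>x'\<in>X. \<forall>u\<in>U. tv_dist (T x u) (T x' u) \<le> \<alpha>T * l1_norm (x - x')\<close> that by blast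
    show "sets \<mu> = sets (restrict_space borel X)"
      using \<open>sets \<mu> = sets MX\<close> by (simp only: MX_def)
    show "emeasure \<mu> A \<le> emeasure (T x u) A"
      if "x \<in> X" "u \<in> U" "A \<in> sets (restrict_space borel X)" for x u A
      using \<open>\<forall>x\<in>X. \<forall>u\<in>U. \<forall>A\<in>sets MX. emeasure \<mu> A \<le> emeasure (T x u) A\<close> that
      unfolding MX_def by blast
    show "0 \<le> V x" if "x \<in> X" for x
      using \<open>\<forall>x\<in>X. 0 \<le> V x\<close> that by blast
    show "integrable (T x u) V" "(LINT x'|T x u. V x') \<le> V x - l1_norm x powr m + b"
      if "x \<in> X" "u \<in> U" for x u
      using \<open>\<forall>x\<in>X. \<forall>u\<in>U. integrable (T x u) V \<and> (LINT x'|T x u. V x') \<le> V x - l1_norm x powr m + b\<close>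
        that by blast+
    show "0 \<le> \<alpha>c" "0 \<le> \<alpha>T" using \<open>\<alpha>c > 0\<close> \<open>\<alpha>T > 0\<close> by simp_all
  qed (fact \<open>finite U\<close> \<open>U \<noteq> {}\<close> \<open>emeasure \<mu> X > 0\<close> c_meas cK)+
  obtain y0 where y0: "y0 \<in> X" "l1_norm y0 powr m \<le> b"
    using exists_sublevel_point by blast
  let ?D = "(2 * real CARD('n) + 1) * b powr (1 / m) / real M powr (1 / real CARD('n) * (1 - 1 / m))"
  obtain S where S: "finite S" "S \<subseteq> X" "card S = M"
    and good: "\<And>e. 0 < e \<Longrightarrow> \<exists>a k. 0 \<le> k \<and> a + k * b \<le> ?D + e \<and>
      (\<forall>x\<in>X. \<exists>s\<in>S. l1_norm (x - s) \<le> a + k * l1_norm x powr m)"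
    by (rule exists_quantization_points[OF \<open>m > 1\<close> \<open>b \<ge> 0\<close> \<open>M \<ge> 1\<close> \<open>finite X \<longrightarrow> M \<le> card X\<close> y0], rule that)
  obtain B y \<pi> where Q: "quantizer X M B y \<pi>" "y ` {..<M} = S"
    "\<And>i. i < M \<Longrightarrow> uniform_measure \<pi> (B i) = return (restrict_space borel X) (y i)"
    and near: "\<And>x s. x \<in> X \<Longrightarrow> s \<in> S \<Longrightarrow> l1_norm (x - quantize M B y x) \<le> l1_norm (x - s)"
    by (rule nearest_point_quantizer[OF S \<open>M \<ge> 1\<close>], rule that)
  interpret quantized_mdp X U T c V "\<lambda>x. l1_norm x powr m" \<mu> K \<alpha>c \<alpha>T b M B y \<pi>
    by unfold_locales (fact Q(1) Q(3))+
  define L where "L = \<alpha>c + \<alpha>T * K / measure \<mu> X"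
  have L: "L > 0"
    using \<open>\<alpha>c > 0\<close> \<open>\<alpha>T > 0\<close> K_nonneg measure_\<mu>_pos by (simp add: L_def add_pos_nonneg)
  have "\<bar>finite_opt_avg_cost M B y \<pi> MU T c x\<^sub>0 - opt_avg_cost MX MU T c x\<^sub>0\<bar> \<le> ereal (L * ?D)"
    if x0: "x\<^sub>0 \<in> X" for x\<^sub>0
  \<comment> \<open>The quantizer is fixed before \<open>e\<close>; a slack of \<open>e / L\<close>
    in the covering becomes \<open>e\<close> in the cost and can be made arbitrarily small.\<close>
  proof (rule ereal_le_epsilon2)
    fix e :: real assume "0 < e"
    then obtain a k where k: "0 \<le> k" "a + k * b \<le> ?D + e / L"
      and cover: "\<forall>x\<in>X. \<exists>s\<in>S. l1_norm (x - s) \<le> a + k * l1_norm x powr m"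
      using good[of "e / L"] L by auto
    have "l1_norm (x - quantize M B y x) \<le> a + k * l1_norm x powr m" if "x \<in> X" for x
      using cover near[OF that] that by (meson order_trans)
    from quantized_cost_error[OF x0 k(1) this]
    have "\<bar>finite_opt_avg_cost M B y \<pi> MU T c x\<^sub>0 - opt_avg_cost MX MU T c x\<^sub>0\<bar> \<le> ereal (L * (a + k * b))"
      by (simp add: L_def MX_def MU_def)
    also have "L * (a + k * b) \<le> L * (?D + e / L)"
      using k(2) L by (intro mult_left_mono) auto
    also have "\<dots> = L * ?D + e" using L by (simp add: field_simps)
    finally show "\<bar>finite_opt_avg_cost M B y \<pi> MU T c x\<^sub>0 - opt_avg_cost MX MU T c x\<^sub>0\<bar> \<le> ereal (L * ?D) + ereal e"
      by simp
  qed
  then show ?thesis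
    using Q(1) by (intro exI[of _ B] exI[of _ y] exI[of _ \<pi>]) (simp add: L_def K_def)
qed

end
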